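(* Let $k$ be an algebraically closed field with $\operatorname{char}(k)\ne2$, let $A=A(\alpha,\beta,\gamma)$ be a 4-dimensional Sklyanin algebra over $k$ whose associated automorphism $\sigma$ has infinite order, and let $B^{G,\mu}$ be the cocycle twist of $B=A/(\Omega_1,\Omega_2)$ described in the context. Then $B^{G,\mu}$ has no point modules.
   Context: A point module over a connected graded algebra is a cyclic $\mathbb{N}$-graded right module with Hilbert series $1/(1-t)$. Write $[x,y]=xy-yx$, $[x,y]_+=xy+yx$. The parameters satisfy $\alpha+\beta+\gamma+\alpha\beta\gamma=0$, $\{\alpha,\beta,\gamma\}\cap\{0,\pm1\}=\emptyset$; $A$ is generated by $x_0,\dots,x_3$ (degree 1) with relations $[x_0,x_1]-\alpha[x_2,x_3]_+$, $[x_0,x_1]_+-[x_2,x_3]$, $[x_0,x_2]-\beta[x_3,x_1]_+$, $[x_0,x_2]_+-[x_3,x_1]$, $[x_0,x_3]-\gamma[x_1,x_2]_+$, $[x_0,x_3]_+-[x_1,x_2]$. Associated geometry: the elliptic curve $E\subset\mathbb{P}^3_k$, $y_0^2+y_1^2+y_2^2+y_3^2=0$, $y_3^2+\frac{1-\gamma}{1+\alpha}y_1^2+\frac{1+\gamma}{1-\beta}y_2^2=0$, parameterises (with four extra points) the point modules over $A$; $\sigma$ is the translation automorphism of $E$ with $M_p[1]_{\ge0}\cong M_{\sigma(p)}$, where $M_p$ is the point module of $p\in E$. $\Omega_1=-x_0^2+x_1^2+x_2^2+x_3^2$ and $\Omega_2=x_1^2+\frac{1+\alpha}{1-\beta}x_2^2+\frac{1-\alpha}{1+\gamma}x_3^2$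 are central in $A$, and $B=A/(\Omega_1,\Omega_2)$. $G=\langle g_1,g_2\rangle\cong(C_2)^2$ acts on $B$ by $x_0^{g_1}=x_0$, $x_1^{g_1}=x_1$, $x_2^{g_1}=-x_2$, $x_3^{g_1}=-x_3$, $x_i^{g_2}=(-1)^ix_i$, inducing a $G$-grading with $x_0,x_1,x_2,x_3$ in degrees $e,g_1,g_2,g_1g_2$. With $\mu(g_1^pg_2^q,g_1^rg_2^s)=(-1)^{ps}$ ($p,q,r,s\in\{0,1\}$), $B^{G,\mu}$ is $B$ with multiplication $a\ast_\mu b=\mu(g,h)ab$ for $a\in B_g,b\in B_h$. *)

theory Defs
  imports
    "HOL-Algebra.QuotRing"
    "HOL-Library.Poly_Mapping"
    "HOL-Computational_Algebra.Polynomial"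
    "HOL-Computational_Algebra.Formal_Power_Series"
begin

section \<open>Graded algebras over a field and graded right modules\<close>

text \<open>
  An \<open>\<nat>\<close>-graded \<open>k\<close>-algebra is given by a ring, the structure map \<open>scal\<close> from \<open>k\<close> to the
  (degree zero part of the) ring, and the homogeneous components.  The records carry data only.
\<close>

record ('k, 'a) graded_algebra = "'a ring" +
  scal :: "'k \<Rightarrow> 'a"
  piece :: "nat \<Rightarrow> 'a set"

text \<open>
  The fields \<open>mult\<close> and \<open>one\<close> inherited from \<open>ring\<close> play no role for modules (as in
  the module record of HOL-Algebra).
\<close>

record ('a, 'm) graded_rmodule = "'m ring" +
  ract :: "'m \<Rightarrow> 'a \<Rightarrow> 'm"  (infixl \<open>\<odot>\<index>\<close> 70)
  mpiece :: "nat \<Rightarrow> 'm set"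

definition internal_direct_sum :: "('m, 'z) ring_scheme \<Rightarrow> ('i \<Rightarrow> 'm set) \<Rightarrow> bool" where
  "internal_direct_sum M V \<longleftrightarrow>
     (\<forall>i. additive_subgroup (V i) M) \<and>
     (\<forall>m\<in>carrier M. \<exists>!c. (\<forall>i. c i \<in> V i) \<and> finite {i. c i \<noteq> \<zero>\<^bsub>M\<^esub>} \<and>
        m = finsum M c {i. c i \<noteq> \<zero>\<^bsub>M\<^esub>})"

definition component :: "('m, 'z) ring_scheme \<Rightarrow> ('i \<Rightarrow> 'm set) \<Rightarrow> 'i \<Rightarrow> 'm \<Rightarrow> 'm" where
  "component M V i m =
     (THE c. (\<forall>j. c j \<in> V j) \<and> finite {j. c j \<noteq> \<zero>\<^bsub>M\<^esub>} \<and>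
        m = finsum M c {j. c j \<noteq> \<zero>\<^bsub>M\<^esub>}) i"

definition graded_right_module ::
    "('k, 'a) graded_algebra \<Rightarrow> ('a, 'm) graded_rmodule \<Rightarrow> bool" where
  "graded_right_module R M \<longleftrightarrow>
     abelian_group M \<and>
     (\<forall>m\<in>carrier M. \<forall>a\<in>carrier R. m \<odot>\<^bsub>M\<^esub> a \<in> carrier M) \<and>
     (\<forall>m\<in>carrier M. \<forall>m'\<in>carrier M. \<forall>a\<in>carrier R.
        (m \<oplus>\<^bsub>M\<^esub> m') \<odot>\<^bsub>M\<^esub> a = (m \<odot>\<^bsub>M\<^esub> a) \<oplus>\<^bsub>M\<^esub> (m' \<odot>\<^bsub>M\<^esub> a)) \<and>
     (\<forall>m\<in>carrier M. \<forall>a\<in>carrier R. \<forall>b\<in>carrier R.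
        m \<odot>\<^bsub>M\<^esub> (a \<oplus>\<^bsub>R\<^esub> b) = (m \<odot>\<^bsub>M\<^esub> a) \<oplus>\<^bsub>M\<^esub> (m \<odot>\<^bsub>M\<^esub> b)) \<and>
     (\<forall>m\<in>carrier M. \<forall>a\<in>carrier R. \<forall>b\<in>carrier R.
        m \<odot>\<^bsub>M\<^esub> (a \<otimes>\<^bsub>R\<^esub> b) = (m \<odot>\<^bsub>M\<^esub> a) \<odot>\<^bsub>M\<^esub> b) \<and>
     (\<forall>m\<in>carrier M. m \<odot>\<^bsub>M\<^esub> \<one>\<^bsub>R\<^esub> = m) \<and>
     internal_direct_sum M (mpiece M) \<and>
     (\<forall>n i. \<forall>m\<in>mpiece M n. \<forall>a\<in>piece R i. m \<odot>\<^bsub>M\<^esub> a \<in> mpiece M (n + i))"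

definition cyclic_module :: "('k, 'a) graded_algebra \<Rightarrow> ('a, 'm) graded_rmodule \<Rightarrow> bool" where
  "cyclic_module R M \<longleftrightarrow> (\<exists>m\<in>carrier M. carrier M = {m \<odot>\<^bsub>M\<^esub> a | a. a \<in> carrier R})"

text \<open>\<open>V\<close> has a \<open>k\<close>-basis \<open>b 0, \<dots>, b (d - 1)\<close>.\<close>

definition has_kdim ::
    "('k::field, 'a) graded_algebra \<Rightarrow> ('a, 'm) graded_rmodule \<Rightarrow> 'm set \<Rightarrow> nat \<Rightarrow> bool" where
  "has_kdim R M V d \<longleftrightarrow>
     (\<exists>b :: nat \<Rightarrow> 'm. (\<forall>i<d. b i \<in> V) \<and>
        (\<forall>v\<in>V. \<exists>!c :: nat \<Rightarrow> 'k. (\<forall>i\<ge>d. c i = 0) \<and>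
           v = finsum M (\<lambda>i. b i \<odot>\<^bsub>M\<^esub> scal R (c i)) {..<d}))"

definition has_hilbert_series ::
    "('k::field, 'a) graded_algebra \<Rightarrow> ('a, 'm) graded_rmodule \<Rightarrow> rat fps \<Rightarrow> bool" where
  "has_hilbert_series R M h \<longleftrightarrow>
     (\<forall>n. \<exists>d. has_kdim R M (mpiece M n) d \<and> fps_nth h n = of_nat d)"

definition point_module :: "('k::field, 'a) graded_algebra \<Rightarrow> ('a, 'm) graded_rmodule \<Rightarrow> bool" where
  "point_module R M \<longleftrightarrow>
     graded_right_module R M \<and> cyclic_module R M \<and> has_hilbert_series R M (1 / (1 - fps_X))"

definition graded_module_iso ::
    "('k, 'a) graded_algebra \<Rightarrow> ('a, 'm) graded_rmodule \<Rightarrow> ('a, 'n) graded_rmodule \<Rightarrow> bool" where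
  "graded_module_iso R M N \<longleftrightarrow>
     (\<exists>f. bij_betw f (carrier M) (carrier N) \<and>
        (\<forall>m\<in>carrier M. \<forall>m'\<in>carrier M. f (m \<oplus>\<^bsub>M\<^esub> m') = f m \<oplus>\<^bsub>N\<^esub> f m') \<and>
        (\<forall>m\<in>carrier M. \<forall>a\<in>carrier R. f (m \<odot>\<^bsub>M\<^esub> a) = f m \<odot>\<^bsub>N\<^esub> a) \<and>
        (\<forall>n. f ` mpiece M n = mpiece N n))"

text \<open>The truncated shift \<open>M[1]\<^sub>\<ge>\<^sub>0\<close>, the direct sum of the \<open>M\<^sub>n\<^sub>+\<^sub>1\<close> with \<open>n \<ge> 0\<close>.\<close>

definition shift_trunc :: "('a, 'm) graded_rmodule \<Rightarrow> ('a, 'm) graded_rmodule" where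
  "shift_trunc M = M
     \<lparr>carrier := {finsum M c F | c F. finite F \<and> (\<forall>n\<in>F. c n \<in> mpiece M (Suc n))},
      mpiece := (\<lambda>n. mpiece M (Suc n))\<rparr>"

definition quot_algebra :: "('k, 'a) graded_algebra \<Rightarrow> 'a set \<Rightarrow> ('k, 'a set) graded_algebra" where
  "quot_algebra R I =
     \<lparr>carrier = carrier (R Quot I), monoid.mult = monoid.mult (R Quot I), one = one (R Quot I),
      zero = zero (R Quot I), add = add (R Quot I),
      scal = (\<lambda>c. I +>\<^bsub>R\<^esub> scal R c),
      piece = (\<lambda>n. (\<lambda>a. I +>\<^bsub>R\<^esub> a) ` piece R n)\<rparr>"

definition right_ideal :: "'a set \<Rightarrow> ('a, 'z) ring_scheme \<Rightarrow> bool" where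
  "right_ideal J R \<longleftrightarrow> additive_subgroup J R \<and> (\<forall>a\<in>J. \<forall>x\<in>carrier R. a \<otimes>\<^bsub>R\<^esub> x \<in> J)"

definition gen_right_ideal :: "('a, 'z) ring_scheme \<Rightarrow> 'a set \<Rightarrow> 'a set" where
  "gen_right_ideal R S = \<Inter>{J. right_ideal J R \<and> S \<subseteq> J}"

text \<open>The graded right module \<open>R / J\<close> for a (homogeneous) right ideal \<open>J\<close>.\<close>

definition quot_module :: "('k, 'a) graded_algebra \<Rightarrow> 'a set \<Rightarrow> ('a, 'a set) graded_rmodule" where
  "quot_module R J =
     \<lparr>carrier = a_rcosets\<^bsub>R\<^esub> J, monoid.mult = undefined, one = undefined, zero = J, add = set_add R,
      ract = (\<lambda>X a. \<Union>x\<in>X. J +>\<^bsub>R\<^esub> (x \<otimes>\<^bsub>R\<^esub> a)),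
      mpiece = (\<lambda>n. (\<lambda>a. J +>\<^bsub>R\<^esub> a) ` piece R n)\<rparr>"

section \<open>The free algebra on four generators\<close>

datatype gen = X0 | X1 | X2 | X3

text \<open>The free monoid on the generators, written additively so that \<open>word \<Rightarrow>\<^sub>0 k\<close> is its monoid algebra.\<close>

datatype word = Word (letters: "gen list")

instantiation word :: monoid_add
begin
definition "0 = Word []"
definition "u + v = Word (letters u @ letters v)"
instance by standard (simp_all add: zero_word_def plus_word_def)
end

type_synonym 'k free = "word \<Rightarrow>\<^sub>0 'k"

definition const :: "'k::field \<Rightarrow> 'k free" where
  "const c = Poly_Mapping.single 0 c"

definition var :: "gen \<Rightarrow> 'k::field free" where
  "var i = Poly_Mapping.single (Word [i]) 1"

definition free_algebra :: "('k::field, 'k free) graded_algebra" where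
  "free_algebra =
     \<lparr>carrier = UNIV, monoid.mult = (*), one = 1, zero = 0, add = (+),
      scal = const,
      piece = (\<lambda>n. {f. \<forall>w\<in>Poly_Mapping.keys f. length (letters w) = n})\<rparr>"

lemma ring_free_algebra: "ring (free_algebra :: ('k::field, 'k free) graded_algebra)"
proof (rule ringI)
  show "abelian_group (free_algebra :: ('k, 'k free) graded_algebra)"
  proof (rule abelian_groupI)
    fix x :: "'k free"
    show "\<exists>y\<in>carrier free_algebra. y \<oplus>\<^bsub>free_algebra\<^esub> x = \<zero>\<^bsub>free_algebra\<^esub>"
      by (rule bexI[of _ "- x"]) (simp_all add: free_algebra_def)
  qed (simp_all add: free_algebra_def algebra_simps)
  show "Group.monoid (free_algebra :: ('k, 'k free) graded_algebra)"
    by (rule monoidI) (simp_all add: free_algebra_def algebra_simps)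
qed (simp_all add: free_algebra_def algebra_simps)

section \<open>The Sklyanin algebra and its factor ring\<close>

definition comm :: "'a::ring \<Rightarrow> 'a \<Rightarrow> 'a" where
  "comm a b = a * b - b * a"

definition anticomm :: "'a::ring \<Rightarrow> 'a \<Rightarrow> 'a" where
  "anticomm a b = a * b + b * a"

definition sklyanin_params :: "'k::field \<Rightarrow> 'k \<Rightarrow> 'k \<Rightarrow> bool" where
  "sklyanin_params \<alpha> \<beta> \<gamma> \<longleftrightarrow>
     \<alpha> + \<beta> + \<gamma> + \<alpha> * \<beta> * \<gamma> = 0 \<and> {\<alpha>, \<beta>, \<gamma>} \<inter> {0, 1, - 1} = {}"

definition sklyanin_rels :: "'k::field \<Rightarrow> 'k \<Rightarrow> 'k \<Rightarrow> 'k free set" where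
  "sklyanin_rels \<alpha> \<beta> \<gamma> =
     {comm (var X0) (var X1) - const \<alpha> * anticomm (var X2) (var X3),
      anticomm (var X0) (var X1) - comm (var X2) (var X3),
      comm (var X0) (var X2) - const \<beta> * anticomm (var X3) (var X1),
      anticomm (var X0) (var X2) - comm (var X3) (var X1),
      comm (var X0) (var X3) - const \<gamma> * anticomm (var X1) (var X2),
      anticomm (var X0) (var X3) - comm (var X1) (var X2)}"

definition sklyanin_ideal :: "'k::field \<Rightarrow> 'k \<Rightarrow> 'k \<Rightarrow> 'k free set" where
  "sklyanin_ideal \<alpha> \<beta> \<gamma> = Idl\<^bsub>free_algebra\<^esub> (sklyanin_rels \<alpha> \<beta> \<gamma>)"

definition sklyanin :: "'k::field \<Rightarrow> 'k \<Rightarrow> 'k \<Rightarrow> ('k, 'k free set) graded_algebra" where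
  "sklyanin \<alpha> \<beta> \<gamma> = quot_algebra free_algebra (sklyanin_ideal \<alpha> \<beta> \<gamma>)"

definition to_sklyanin :: "'k::field \<Rightarrow> 'k \<Rightarrow> 'k \<Rightarrow> 'k free \<Rightarrow> 'k free set" where
  "to_sklyanin \<alpha> \<beta> \<gamma> f = sklyanin_ideal \<alpha> \<beta> \<gamma> +>\<^bsub>free_algebra\<^esub> f"

definition Omega1 :: "'k::field \<Rightarrow> 'k \<Rightarrow> 'k \<Rightarrow> 'k free set" where
  "Omega1 \<alpha> \<beta> \<gamma> = to_sklyanin \<alpha> \<beta> \<gamma> (- ((var X0)^2) + (var X1)^2 + (var X2)^2 + (var X3)^2)"

definition Omega2 :: "'k::field \<Rightarrow> 'k \<Rightarrow> 'k \<Rightarrow> 'k free set" where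
  "Omega2 \<alpha> \<beta> \<gamma> = to_sklyanin \<alpha> \<beta> \<gamma>
     ((var X1)^2 + const ((1 + \<alpha>) / (1 - \<beta>)) * (var X2)^2 + const ((1 - \<alpha>) / (1 + \<gamma>)) * (var X3)^2)"

definition algebra_B :: "'k::field \<Rightarrow> 'k \<Rightarrow> 'k \<Rightarrow> ('k, 'k free set set) graded_algebra" where
  "algebra_B \<alpha> \<beta> \<gamma> =
     quot_algebra (sklyanin \<alpha> \<beta> \<gamma>) (Idl\<^bsub>sklyanin \<alpha> \<beta> \<gamma>\<^esub> {Omega1 \<alpha> \<beta> \<gamma>, Omega2 \<alpha> \<beta> \<gamma>})"

section \<open>The elliptic curve and its automorphism\<close>

text \<open>A point of \<open>\<PP>\<^sup>3\<close> is a line through the origin of \<open>k\<^sup>4\<close>, as a set of coordinate vectors.\<close>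

type_synonym 'k point = "(gen \<Rightarrow> 'k) set"

definition proj3 :: "'k::field point set" where
  "proj3 = {range (\<lambda>c i. c * v i) | v. v \<noteq> (\<lambda>_. 0)}"

definition curve_E :: "'k::field \<Rightarrow> 'k \<Rightarrow> 'k \<Rightarrow> 'k point set" where
  "curve_E \<alpha> \<beta> \<gamma> = {p \<in> proj3. \<forall>y\<in>p.
     (y X0)^2 + (y X1)^2 + (y X2)^2 + (y X3)^2 = 0 \<and>
     (y X3)^2 + (1 - \<gamma>) / (1 + \<alpha>) * (y X1)^2 + (1 + \<gamma>) / (1 - \<beta>) * (y X2)^2 = 0}"

definition linear_form :: "(gen \<Rightarrow> 'k::field) \<Rightarrow> 'k free" where
  "linear_form c = const (c X0) * var X0 + const (c X1) * var X1 +
                   const (c X2) * var X2 + const (c X3) * var X3"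

definition vanishing_forms :: "'k::field point \<Rightarrow> 'k free set" where
  "vanishing_forms p = {linear_form c | c.
     \<forall>y\<in>p. c X0 * y X0 + c X1 * y X1 + c X2 * y X2 + c X3 * y X3 = 0}"

text \<open>
  The module \<open>M\<^sub>p = A / p\<^sup>\<bottom>A\<close>, where \<open>p\<^sup>\<bottom>\<close> is the space of elements of
  \<open>A\<^sub>1\<close> vanishing at \<open>p\<close>; for \<open>p\<close> on the curve it is the point module corresponding to \<open>p\<close>
  (Levasseur and Smith).
\<close>

definition point_module_at :: "'k::field \<Rightarrow> 'k \<Rightarrow> 'k \<Rightarrow> 'k point \<Rightarrow>
    ('k free set, 'k free set set) graded_rmodule" where
  "point_module_at \<alpha> \<beta> \<gamma> p =
     quot_module (sklyanin \<alpha> \<beta> \<gamma>)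
       (gen_right_ideal (sklyanin \<alpha> \<beta> \<gamma>) (to_sklyanin \<alpha> \<beta> \<gamma> ` vanishing_forms p))"

text \<open>
  Distinct points have non-isomorphic modules \<open>M\<^sub>p\<close> (the annihilator of the degree zero part in
  \<open>A\<^sub>1\<close> recovers \<open>p\<close>), so the last condition determines \<open>\<sigma>\<close> on the curve.
\<close>

definition sklyanin_automorphism ::
    "'k::field \<Rightarrow> 'k \<Rightarrow> 'k \<Rightarrow> ('k point \<Rightarrow> 'k point) \<Rightarrow> bool" where
  "sklyanin_automorphism \<alpha> \<beta> \<gamma> \<sigma> \<longleftrightarrow>
     bij_betw \<sigma> (curve_E \<alpha> \<beta> \<gamma>) (curve_E \<alpha> \<beta> \<gamma>) \<and>
     (\<forall>p\<in>curve_E \<alpha> \<beta> \<gamma>. graded_module_iso (sklyanin \<alpha> \<beta> \<gamma>)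
        (shift_trunc (point_module_at \<alpha> \<beta> \<gamma> p)) (point_module_at \<alpha> \<beta> \<gamma> (\<sigma> p)))"

definition infinite_order_on :: "('p \<Rightarrow> 'p) \<Rightarrow> 'p set \<Rightarrow> bool" where
  "infinite_order_on \<sigma> S \<longleftrightarrow> (\<forall>n>0. \<exists>p\<in>S. (\<sigma> ^^ n) p \<noteq> p)"

section \<open>The cocycle twist\<close>

text \<open>The element \<open>g\<^sub>1\<^sup>p g\<^sub>2\<^sup>q\<close> of \<open>G\<close> is the pair of truth values \<open>(p = 1, q = 1)\<close>.\<close>

type_synonym klein = "bool \<times> bool"

definition sgn_if :: "bool \<Rightarrow> 'k::field" where
  "sgn_if b = (if b then - 1 else 1)"

text \<open>\<open>x\<^sub>i\<close> is mapped by \<open>g\<close> to \<open>gen_sign g x\<^sub>i * x\<^sub>i\<close>.\<close>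

definition gen_sign :: "klein \<Rightarrow> gen \<Rightarrow> 'k::field" where
  "gen_sign g i = sgn_if (fst g \<and> i \<in> {X2, X3}) * sgn_if (snd g \<and> i \<in> {X1, X3})"

definition act_free :: "klein \<Rightarrow> 'k::field free \<Rightarrow> 'k free" where
  "act_free g f = Poly_Mapping.mapp (\<lambda>w c. prod_list (map (gen_sign g) (letters w)) * c) f"

text \<open>The induced action on the quotient \<open>A\<close> of the free algebra, and then on the quotient \<open>B\<close> of \<open>A\<close>.\<close>

definition act_A :: "klein \<Rightarrow> 'k::field free set \<Rightarrow> 'k free set" where
  "act_A g X = act_free g ` X"

definition act_B :: "klein \<Rightarrow> 'k::field free set set \<Rightarrow> 'k free set set" where
  "act_B g Y = act_A g ` Y"

text \<open>
  The \<open>G\<close>-grading induced by the action has the simultaneous eigenspaces as components, where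
  \<open>g\<^sub>1\<^sup>p g\<^sub>2\<^sup>q\<close> is identified with the character
  \<open>g\<^sub>1\<^sup>r g\<^sub>2\<^sup>s \<mapsto> (-1)\<^sup>p\<^sup>s\<^sup>+\<^sup>q\<^sup>r\<close>; this puts \<open>x\<^sub>0, x\<^sub>1, x\<^sub>2, x\<^sub>3\<close> in degrees
  \<open>e, g\<^sub>1, g\<^sub>2, g\<^sub>1 g\<^sub>2\<close>.
\<close>

definition klein_char :: "klein \<Rightarrow> klein \<Rightarrow> 'k::field" where
  "klein_char g h = sgn_if (fst g \<and> snd h) * sgn_if (snd g \<and> fst h)"

definition G_piece :: "'k::field \<Rightarrow> 'k \<Rightarrow> 'k \<Rightarrow> klein \<Rightarrow> 'k free set set set" where
  "G_piece \<alpha> \<beta> \<gamma> g = {b \<in> carrier (algebra_B \<alpha> \<beta> \<gamma>). \<forall>h.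
     act_B h b = scal (algebra_B \<alpha> \<beta> \<gamma>) (klein_char g h) \<otimes>\<^bsub>algebra_B \<alpha> \<beta> \<gamma>\<^esub> b}"

definition cocycle :: "klein \<Rightarrow> klein \<Rightarrow> 'k::field" where
  "cocycle g h = sgn_if (fst g \<and> snd h)"

text \<open>
  The multiplication of the twist is the bi-additive extension of \<open>a * b = \<mu> g h a b\<close> for
  homogeneous \<open>a\<close> and \<open>b\<close> of degrees \<open>g\<close> and \<open>h\<close>.
\<close>

definition cocycle_twist :: "('k, 'a) graded_algebra \<Rightarrow> (klein \<Rightarrow> 'a set) \<Rightarrow>
    (klein \<Rightarrow> klein \<Rightarrow> 'k) \<Rightarrow> ('k, 'a) graded_algebra" where
  "cocycle_twist R V \<mu> = R
     \<lparr>monoid.mult := (\<lambda>a b. finsum R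
        (\<lambda>(g, h). scal R (\<mu> g h) \<otimes>\<^bsub>R\<^esub> (component R V g a \<otimes>\<^bsub>R\<^esub> component R V h b)) UNIV)\<rparr>"

definition B_twist :: "'k::field \<Rightarrow> 'k \<Rightarrow> 'k \<Rightarrow> ('k, 'k free set set) graded_algebra" where
  "B_twist \<alpha> \<beta> \<gamma> = cocycle_twist (algebra_B \<alpha> \<beta> \<gamma>) (G_piece \<alpha> \<beta> \<gamma>) cocycle"

end

theory Submission
  imports Defs
begin

text \<open>
  In a point module \<open>M\<close> over the twist every \<open>M\<^sub>n\<close> is spanned by some \<open>e\<^sub>n\<close>, and \<open>e\<^sub>0 x\<^sub>i = p\<^sub>i e\<^sub>1\<close>,
  \<open>e\<^sub>1 x\<^sub>j = q\<^sub>j e\<^sub>2\<close> with nonzero vectors \<open>p\<close> and \<open>q\<close>. The quadratic relations of the twist become bilinear equations in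
  \<open>p\<close> and \<open>q\<close>. The \<open>2 \<times> 2\<close> minors of the matrix \<open>p\<^sub>i q\<^sub>j\<close> show that the six equations coming from the Sklyanin
  relations have, apart from the four coordinate points \<open>p = q\<close>, only solutions in which the ratios of the numbers
  \<open>p\<^sub>i q\<^sub>i\<close> are monomials in the parameters up to sign; the equation coming from \<open>\<Omega>\<^sub>1\<close> excludes all of them.
\<close>

section \<open>The bilinear equations\<close>

lemma twisted_relations_no_solution:
  fixes \<alpha> \<beta> \<gamma> p0 p1 p2 p3 q0 q1 q2 q3 :: "'k::field"
  assumes two: "(2::'k) \<noteq> 0" and par: "sklyanin_params \<alpha> \<beta> \<gamma>"
    and r: "p0 * q1 - p1 * q0 = \<alpha> * (p2 * q3 - p3 * q2)" "p0 * q1 + p1 * q0 = p2 * q3 + p3 * q2"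
      "p0 * q2 - p2 * q0 = \<beta> * (p3 * q1 - p1 * q3)" "p0 * q2 + p2 * q0 = p3 * q1 + p1 * q3"
      "p0 * q3 - p3 * q0 = \<gamma> * (p2 * q1 - p1 * q2)" "p0 * q3 + p3 * q0 = - (p1 * q2 + p2 * q1)"
      "p1 * q1 + p2 * q2 = p0 * q0 + p3 * q3"
  shows "(p0 = 0 \<and> p1 = 0 \<and> p2 = 0 \<and> p3 = 0) \<or> (q0 = 0 \<and> q1 = 0 \<and> q2 = 0 \<and> q3 = 0)"
proof -
  have par1: "\<alpha> + \<beta> + \<gamma> + \<alpha> * \<beta> * \<gamma> = 0"
    and nz: "\<alpha> \<noteq> 0" "\<beta> \<noteq> 0" "\<gamma> \<noteq> 0" "1 - \<alpha> \<noteq> 0" "1 - \<beta> \<noteq> 0" "1 - \<gamma> \<noteq> 0"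
      "1 + \<alpha> \<noteq> 0" "1 + \<beta> \<noteq> 0" "1 + \<gamma> \<noteq> 0"
    using par by (auto simp: sklyanin_params_def add_eq_0_iff)
  have four: "(4::'k) \<noteq> 0"
    using two by (metis mult_2 mult_eq_0_iff numeral_Bit0 one_add_one)
  \<comment> \<open>The first six equations express the products \<open>p0 * qi\<close> and
    \<open>pi * q0\<close> through the products without index 0. So all twelve off-diagonal entries
    of the matrix of products are linear in these sums and differences; they are kept doubled in
    \<open>h\<close> to avoid fractions.\<close>
  define s1 a1 s2 a2 s3 a3 where "s1 = p2 * q3 + p3 * q2" and "a1 = p2 * q3 - p3 * q2"
    and "s2 = p3 * q1 + p1 * q3" and "a2 = p3 * q1 - p1 * q3"
    and "s3 = p1 * q2 + p2 * q1" and "a3 = p1 * q2 - p2 * q1"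
  note defs = this
  have e: "2 * x = (x + y) + (x - y)" "2 * y = (x + y) - (x - y)" for x y :: 'k by simp_all
  have h: "2 * (p0 * q1) = s1 + \<alpha> * a1" "2 * (p1 * q0) = s1 - \<alpha> * a1"
    "2 * (p2 * q3) = s1 + a1" "2 * (p3 * q2) = s1 - a1"
    "2 * (p0 * q2) = s2 + \<beta> * a2" "2 * (p2 * q0) = s2 - \<beta> * a2"
    "2 * (p3 * q1) = s2 + a2" "2 * (p1 * q3) = s2 - a2"
    "2 * (p0 * q3) = - s3 - \<gamma> * a3" "2 * (p3 * q0) = - s3 + \<gamma> * a3"
    "2 * (p1 * q2) = s3 + a3" "2 * (p2 * q1) = s3 - a3"
    using e[where x = "p0 * q1" and y = "p1 * q0"] e[where x = "p0 * q2" and y = "p2 * q0"]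
      e[where x = "p0 * q3" and y = "p3 * q0"]
    unfolding r(1-6) defs by (simp_all add: algebra_simps)
  define d0 d1 d2 d3 where "d0 = p0 * q0" and "d1 = p1 * q1" and "d2 = p2 * q2" and "d3 = p3 * q3"
  note ddefs = this
  \<comment> \<open>Each is \<open>(pi * qi) * (pj * qj) = (pi * qj) * (pj * qi)\<close>, a minor
    with two diagonal entries.\<close>
  have D: "4 * (d0 * d1) = (s1 + \<alpha> * a1) * (s1 - \<alpha> * a1)" "4 * (d2 * d3) = (s1 + a1) * (s1 - a1)"
    "4 * (d0 * d2) = (s2 + \<beta> * a2) * (s2 - \<beta> * a2)" "4 * (d1 * d3) = (s2 + a2) * (s2 - a2)"
    "4 * (d0 * d3) = (- s3 - \<gamma> * a3) * (- s3 + \<gamma> * a3)" "4 * (d1 * d2) = (s3 + a3) * (s3 - a3)"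
    unfolding h[symmetric] ddefs by simp_all
  \<comment> \<open>The \<open>2 \<times> 2\<close> minors of the rank one matrix \<open>p\<^sub>i q\<^sub>j\<close> without diagonal entries; those with two diagonal entries
    are in \<open>D\<close>.\<close>
  have m: "(s1 + \<alpha> * a1) * (s1 + a1) = (- s3 - \<gamma> * a3) * (s3 - a3)"
    "(s1 - \<alpha> * a1) * (s1 - a1) = (- s3 + \<gamma> * a3) * (s3 + a3)"
    "(s1 + \<alpha> * a1) * (s1 - a1) = (s2 + \<beta> * a2) * (s2 + a2)"
    "(s1 - \<alpha> * a1) * (s1 + a1) = (s2 - \<beta> * a2) * (s2 - a2)"
    "(s2 + \<beta> * a2) * (s2 - a2) = (- s3 - \<gamma> * a3) * (s3 + a3)"
    "(s2 - \<beta> * a2) * (s2 + a2) = (- s3 + \<gamma> * a3) * (s3 - a3)"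
    unfolding h[symmetric] by (simp_all only: mult_ac)
  have half: "x = y" if "2 * x = 2 * y" for x y :: 'k using that two by simp
  have lin: "x = y" if "x - y = c1 * (l1 - r1) + c2 * (l2 - r2) + c3 * (l3 - r3)" "l1 = r1" "l2 = r2" "l3 = r3"
    for x y c1 c2 c3 l1 r1 l2 r2 l3 r3 :: 'k using that by simp
  \<comment> \<open>The minors in \<open>m\<close> come in pairs that differ by changing the signs
    of all \<open>a\<close>. Subtracting the two members of a pair leaves the mixed terms, as here;
    adding them leaves the squares, as in \<open>L\<close>.\<close>
  have P: "(1 + \<alpha>) * (s1 * a1) = (1 - \<gamma>) * (s3 * a3)"
     "(1 - \<alpha>) * (s1 * a1) = - (1 + \<beta>) * (s2 * a2)"
     "(1 - \<beta>) * (s2 * a2) = (1 + \<gamma>) * (s3 * a3)"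
    subgoal by (rule half, rule lin[OF _ m(1,2) refl[of 0], of _ _ 1 "-1" 0]) (simp add: algebra_simps)
    subgoal by (rule half, rule lin[OF _ m(3,4) refl[of 0], of _ _ "-1" 1 0]) (simp add: algebra_simps)
    subgoal by (rule half, rule lin[OF _ m(5,6) refl[of 0], of _ _ "-1" 1 0]) (simp add: algebra_simps)
    done
  have L: "s1^2 + s3^2 = \<gamma> * a3^2 - \<alpha> * a1^2" "s1^2 - s2^2 = \<alpha> * a1^2 + \<beta> * a2^2"
      "s2^2 + s3^2 = \<beta> * a2^2 - \<gamma> * a3^2"
    subgoal by (rule half, rule lin[OF _ m(1,2) refl[of 0], of _ _ 1 1 0])
        (simp add: algebra_simps power2_eq_square)
    subgoal by (rule half, rule lin[OF _ m(3,4) refl[of 0], of _ _ 1 1 0])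
        (simp add: algebra_simps power2_eq_square)
    subgoal by (rule half, rule lin[OF _ m(5,6) refl[of 0], of _ _ 1 1 0])
        (simp add: algebra_simps power2_eq_square)
    done
  have LA: "\<alpha> * a1^2 + \<beta> * a2^2 = \<gamma> * a3^2"
    \<comment> \<open>In the first equation of \<open>L\<close> minus the other two, all squares of
      the \<open>s\<close> cancel.\<close>
    by (rule half, rule lin[OF _ L, of _ _ 1 "-1" "-1"]) (simp add: algebra_simps)
  \<comment> \<open>By the condition on the parameters, \<open>(1 + \<alpha>) (1 + \<beta>) (1 + \<gamma>)\<close> and \<open>(1 - \<alpha>) (1 - \<beta>) (1 - \<gamma>)\<close> are equal,
    so \<open>P\<close> has only the zero solution.\<close>
  have P3: "s3 * a3 = 0"
  proof -
    have pre: "(1 - \<beta>) * ((1 - \<alpha>) * ((1 - \<gamma>) * (s3 * a3))) = - ((1 + \<beta>) * ((1 + \<alpha>) * ((1 + \<gamma>) * (s3 * a3))))"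
      by (rule lin[OF _ P, of _ _ "- (1 - \<beta>) * (1 - \<alpha>)" "(1 - \<beta>) * (1 + \<alpha>)" "- (1 + \<alpha>) * (1 + \<beta>)"])
        (simp add: algebra_simps)
    have "2 * ((1 + \<alpha>) * ((1 + \<beta>) * ((1 + \<gamma>) * (s3 * a3)))) = 0"
      by (rule lin[OF _ pre par1 refl[of 0], of _ _ 1 "2 * (s3 * a3)" 0]) (simp add: algebra_simps)
    then show ?thesis using nz two by simp
  qed
  have P1: "s1 * a1 = 0" using P(1) P3 nz by simp
  have P2: "s2 * a2 = 0" using P(3) P3 nz by simp
  have O: "d1 + d2 = d0 + d3" using r(7) unfolding ddefs .
  have canc: "x = y" if "d \<noteq> 0" "4 * (d * x) = 4 * (d * y)" for x y d :: 'k using that four by simp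
  have "s1 = 0 \<and> a1 = 0 \<and> s2 = 0 \<and> a2 = 0 \<and> s3 = 0 \<and> a3 = 0"
  proof -
    \<comment> \<open>Each \<open>s\<^sub>i a\<^sub>i\<close> vanishes. The surviving cases \<open>A\<close>, \<open>A1\<close>, \<open>A2\<close>, \<open>A3\<close> contain the solutions of the first six
      equations with all coordinates nonzero; there the seventh one forces a product of factors such as \<open>1 - \<beta>\<close> to be zero.\<close>
    consider (A) "a1 = 0" "a2 = 0" "a3 = 0" | (A1) "a1 = 0" "s2 = 0" "s3 = 0"
      | (A2) "s1 = 0" "a2 = 0" "s3 = 0" | (A3) "s1 = 0" "s2 = 0" "a3 = 0"
      | (S) "s1 = 0" "s2 = 0" "s3 = 0"
      | (B1) "s1 = 0" "a2 = 0" "a3 = 0" | (B2) "a1 = 0" "s2 = 0" "a3 = 0" | (B3) "a1 = 0" "a2 = 0" "s3 = 0"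
      using P1 P2 P3 by auto
    then show ?thesis
    proof cases
      case A
      then have S: "s2^2 = s1^2" "s3^2 = - (s1^2)" using L by (simp_all add: algebra_simps eq_neg_iff_add_eq_0)
      have "s1 = 0"
      proof (rule ccontr)
        assume nz_s: "s1 \<noteq> 0"
        \<comment> \<open>All the listed products of diagonal entries are multiples of a single
          square, so cancelling nonzero entries determines all \<open>d\<close> up to a common
          factor; inserted into \<open>O\<close>, this leaves a nonzero multiple of one
          \<open>d\<close>. The next three cases follow the same pattern, there with
          \<open>d0\<close> found by comparing two products of complementary pairs.\<close>
        have E: "4 * (d0 * d1) = s1^2" "4 * (d0 * d2) = s1^2" "4 * (d0 * d3) = - (s1^2)" "4 * (d1 * d2) = - (s1^2)"
          unfolding D A using S by (simp_all add: power2_eq_square)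
        have n: "d0 \<noteq> 0" "d1 \<noteq> 0" using E(1) nz_s by auto
        have e2: "d2 = d1" by (rule canc[OF n(1)]) (use E in simp)
        have e3: "d3 = - d1" by (rule canc[OF n(1)]) (use E in simp)
        have e0: "d0 = - d2" by (rule canc[OF n(2)]) (use E in \<open>simp add: mult.commute[of d1 d0]\<close>)
        have "4 * d1 = (d1 + d2) - (d0 + d3)"
          unfolding e0 unfolding e2 e3 by simp
        then show False using four n O by simp
      qed
      then show ?thesis using S A by simp
    next
      case A1
      then have S: "\<beta> * a2^2 = s1^2" "\<gamma> * a3^2 = s1^2" using L by (simp_all add: algebra_simps eq_neg_iff_add_eq_0)
      have "s1 = 0"
      proof (rule ccontr)
        assume nz_s: "s1 \<noteq> 0"
        have E: "4 * (d0 * d1) = s1^2" "4 * (d2 * d3) = s1^2" "4 * (d0 * d2) = - (\<beta> * s1^2)" "4 * (d0 * d3) = - (\<gamma> * s1^2)"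
          unfolding D A1 using S by (simp_all add: power2_eq_square algebra_simps)
        have n: "d0 \<noteq> 0" "d1 \<noteq> 0" using E(1) nz_s by auto
        have e1: "d2 = - \<beta> * d1" by (rule canc[OF n(1)]) (use E in simp)
        have e2: "d3 = - \<gamma> * d1" by (rule canc[OF n(1)]) (use E in simp)
        have e0: "d0 = \<beta> * \<gamma> * d1"
          by (rule canc[OF n(2)]) (use E(1,2) in \<open>simp add: e1 e2 mult_ac\<close>)
        have "(1 - \<beta>) * (1 + \<gamma>) * d1 = (d1 + d2) - (d0 + d3)"
          unfolding e0 unfolding e1 e2 by (simp add: algebra_simps)
        then show False using nz n O by simp
      qed
      then show ?thesis using S A1 nz by simp
    next
      case A2
      then have S: "\<alpha> * a1^2 = - (s2^2)" "\<gamma> * a3^2 = - (s2^2)" using L by (simp_all add: algebra_simps eq_neg_iff_add_eq_0)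
      have "s2 = 0"
      proof (rule ccontr)
        assume nz_s: "s2 \<noteq> 0"
        have E: "4 * (d0 * d2) = s2^2" "4 * (d1 * d3) = s2^2" "4 * (d0 * d1) = \<alpha> * s2^2" "4 * (d0 * d3) = \<gamma> * s2^2"
          unfolding D A2 using S by (simp_all add: power2_eq_square algebra_simps)
        have n: "d0 \<noteq> 0" "d2 \<noteq> 0" using E(1) nz_s by auto
        have e1: "d1 = \<alpha> * d2" by (rule canc[OF n(1)]) (use E in simp)
        have e2: "d3 = \<gamma> * d2" by (rule canc[OF n(1)]) (use E in simp)
        have e0: "d0 = \<alpha> * \<gamma> * d2"
          by (rule canc[OF n(2)]) (use E(1,2) in \<open>simp add: e1 e2 mult_ac\<close>)
        have "(1 + \<alpha>) * (1 - \<gamma>) * d2 = (d1 + d2) - (d0 + d3)"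
          unfolding e0 unfolding e1 e2 by (simp add: algebra_simps)
        then show False using nz n O by simp
      qed
      then show ?thesis using S A2 nz by simp
    next
      case A3
      then have S: "\<alpha> * a1^2 = - (s3^2)" "\<beta> * a2^2 = s3^2" using L by (simp_all add: algebra_simps eq_neg_iff_add_eq_0)
      have "s3 = 0"
      proof (rule ccontr)
        assume nz_s: "s3 \<noteq> 0"
        have E: "4 * (d0 * d3) = s3^2" "4 * (d1 * d2) = s3^2" "4 * (d0 * d1) = \<alpha> * s3^2" "4 * (d0 * d2) = - (\<beta> * s3^2)"
          unfolding D A3 using S by (simp_all add: power2_eq_square algebra_simps)
        have n: "d0 \<noteq> 0" "d3 \<noteq> 0" using E(1) nz_s by auto
        have e1: "d1 = \<alpha> * d3" by (rule canc[OF n(1)]) (use E in simp)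
        have e2: "d2 = - \<beta> * d3" by (rule canc[OF n(1)]) (use E in simp)
        have e0: "d0 = - \<alpha> * \<beta> * d3"
          by (rule canc[OF n(2)]) (use E(1,2) in \<open>simp add: e1 e2 mult_ac\<close>)
        have "- (1 - \<alpha>) * (1 + \<beta>) * d3 = (d1 + d2) - (d0 + d3)"
          unfolding e0 unfolding e1 e2 by (simp add: algebra_simps)
        then show False using nz n O by simp
      qed
      then show ?thesis using S A3 nz by simp
    next
      \<comment> \<open>In this and the three remaining cases the equations for the squares,
        \<open>L\<close> and \<open>LA\<close>, already admit only zero.\<close>
      case S
      then show ?thesis using L LA nz two by simp
    next
      case B1
      then show ?thesis using L LA nz by simp
    next
      case B2
      then show ?thesis using L LA nz by simp
    next
      case B3
      then show ?thesis using L LA nz by simp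
    qed
  qed
  note van = this
  have dd: "d0 * d1 = 0 \<and> d2 * d3 = 0 \<and> d0 * d2 = 0 \<and> d1 * d3 = 0 \<and> d0 * d3 = 0 \<and> d1 * d2 = 0"
    using D van four by simp
  \<comment> \<open>The pairwise products vanish, so at most one \<open>d\<close> is nonzero; this
    is the place of the four coordinate points, and \<open>O\<close> rules them out.\<close>
  have diag: "d0 = 0" "d1 = 0" "d2 = 0" "d3 = 0"
    using dd O by auto
  have off: "p0 * q1 = 0" "p1 * q0 = 0" "p2 * q3 = 0" "p3 * q2 = 0" "p0 * q2 = 0" "p2 * q0 = 0"
    "p3 * q1 = 0" "p1 * q3 = 0" "p0 * q3 = 0" "p3 * q0 = 0" "p1 * q2 = 0" "p2 * q1 = 0"
    using h van two by simp_all
  consider "p0 = 0" "p1 = 0" "p2 = 0" "p3 = 0" | "p0 \<noteq> 0" | "p1 \<noteq> 0" | "p2 \<noteq> 0" | "p3 \<noteq> 0"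
    by blast
  then show ?thesis
    by cases (use diag[unfolded ddefs] off in simp_all)
qed

section \<open>Quotient algebras\<close>

lemma quot_algebra_simps [simp]:
  "carrier (quot_algebra R I) = a_rcosets\<^bsub>R\<^esub> I"
  "monoid.mult (quot_algebra R I) = rcoset_mult R I"
  "one (quot_algebra R I) = I +>\<^bsub>R\<^esub> one R"
  "zero (quot_algebra R I) = I"
  "add (quot_algebra R I) = set_add R"
  "scal (quot_algebra R I) c = I +>\<^bsub>R\<^esub> scal R c"
  "piece (quot_algebra R I) n = (\<lambda>a. I +>\<^bsub>R\<^esub> a) ` piece R n"
  by (simp_all add: quot_algebra_def FactRing_def)

text \<open>\<open>quot_algebra\<close> copies the operations of \<open>R Quot I\<close> into a
  record with further fields, so the ring laws are transferred from there one by one.\<close>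

lemma ring_quot_algebra:
  assumes "ideal I R"
  shows "ring (quot_algebra R I)"
proof -
  interpret Q: ring "R Quot I"
    using assms by (rule ideal.quotient_is_ring)
  show ?thesis
  proof (rule ringI)
    show "abelian_group (quot_algebra R I)"
    proof (rule abelian_groupI)
      fix x assume "x \<in> carrier (quot_algebra R I)"
      then show "\<exists>y\<in>carrier (quot_algebra R I). y \<oplus>\<^bsub>quot_algebra R I\<^esub> x = \<zero>\<^bsub>quot_algebra R I\<^esub>"
        using Q.l_neg[of x] Q.add.inv_closed[of x] by (auto simp: FactRing_def)
    qed (use Q.a_assoc Q.a_comm Q.zero_closed Q.add.m_closed Q.l_zero in \<open>auto simp: FactRing_def\<close>)
    show "Group.monoid (quot_algebra R I)"
      using Q.m_assoc Q.m_closed Q.one_closed Q.l_one Q.r_one by (intro monoidI) (auto simp: FactRing_def)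
  qed (use Q.l_distr Q.r_distr in \<open>auto simp: FactRing_def\<close>)
qed

lemma quot_algebra_ring_hom:
  assumes "ideal I R"
  shows "(\<lambda>a. I +>\<^bsub>R\<^esub> a) \<in> ring_hom R (quot_algebra R I)"
  using ideal.rcos_ring_hom[OF assms] by (simp add: ring_hom_def FactRing_def)

lemma carrier_quot_algebra: "carrier (quot_algebra R I) = (\<lambda>a. I +>\<^bsub>R\<^esub> a) ` carrier R"
  by (auto simp: A_RCOSETS_def' RCOSETS_def)

text \<open>The preimage of the ideal is an ideal containing the generators, which gives one
  inclusion; since \<open>\<phi>\<close> is an involution, the other one follows. This lets
  \<open>G\<close> act on both successive quotients of the free algebra.\<close>

lemma image_genideal:
  fixes R (structure)
  assumes "ring R" and hom: "\<phi> \<in> ring_hom R R" and inv: "\<And>x. x \<in> carrier R \<Longrightarrow> \<phi> (\<phi> x) = x"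
    and S: "S \<subseteq> carrier R" "\<phi> ` S \<subseteq> Idl\<^bsub>R\<^esub> S"
  shows "\<phi> ` (Idl\<^bsub>R\<^esub> S) = Idl\<^bsub>R\<^esub> S"
proof -
  interpret ring R by fact
  interpret h: ring_hom_ring R R \<phi>
    using hom by (intro ring_hom_ringI2) (simp_all add: ring_axioms)
  have I: "ideal (Idl S) R" by (rule genideal_ideal[OF S(1)])
  have "ideal {r \<in> carrier R. \<phi> r \<in> Idl S} R" by (rule h.ideal_vimage[OF I])
  moreover have "S \<subseteq> {r \<in> carrier R. \<phi> r \<in> Idl S}" using S by auto
  ultimately have "Idl S \<subseteq> {r \<in> carrier R. \<phi> r \<in> Idl S}" by (rule genideal_minimal)
  then show ?thesis using inv by (force simp: image_iff)
qed

lemma image_coset: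
  assumes "ring R" and hom: "\<phi> \<in> ring_hom R R" and "\<phi> ` I = I" and "I \<subseteq> carrier R" "a \<in> carrier R"
  shows "\<phi> ` (I +>\<^bsub>R\<^esub> a) = I +>\<^bsub>R\<^esub> \<phi> a"
proof -
  have "\<phi> ` (I +>\<^bsub>R\<^esub> a) = {\<phi> x \<oplus>\<^bsub>R\<^esub> \<phi> a | x. x \<in> I}"
    using assms(4,5) by (force simp: a_r_coset_def' image_iff ring_hom_add[OF hom] subset_iff)
  also have "\<dots> = {y \<oplus>\<^bsub>R\<^esub> \<phi> a | y. y \<in> \<phi> ` I}" by blast
  finally show ?thesis using assms by (simp add: a_r_coset_def') blast
qed

section \<open>The algebra B\<close>

lemma free_algebra_simps [simp]:
  "carrier free_algebra = UNIV" "monoid.mult free_algebra = (*)" "one free_algebra = 1"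
  "zero free_algebra = 0" "add free_algebra = (+)" "scal free_algebra = const"
  by (simp_all add: free_algebra_def)

text \<open>Reduces statements compatible with sums to scalar multiples of single words.\<close>

lemma free_induct [case_names zero single add]:
  fixes f :: "'a \<Rightarrow>\<^sub>0 'b::monoid_add"
  assumes "P 0" "\<And>w c. P (Poly_Mapping.single w c)" "\<And>f g. P f \<Longrightarrow> P g \<Longrightarrow> P (f + g)"
  shows "P f"
proof (induction f rule: update_induct)
  case (update f a b)
  have "Poly_Mapping.update a b f = Poly_Mapping.single a b + f"
    using update.hyps(1)
    by (intro poly_mapping_eqI) (auto simp: lookup_add lookup_update lookup_single when_def in_keys_iff)
  then show ?case using assms(3)[OF assms(2) update.IH] by simp
qed (rule assms)

lemma lookup_act_free:
  "Poly_Mapping.lookup (act_free g f) w = prod_list (map (gen_sign g) (letters w)) * Poly_Mapping.lookup f w"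
  by (simp add: act_free_def lookup_mapp when_def in_keys_iff)

lemma act_free_single:
  "act_free g (Poly_Mapping.single w c) = Poly_Mapping.single w (prod_list (map (gen_sign g) (letters w)) * c)"
  by (rule poly_mapping_eqI) (simp add: lookup_act_free lookup_single when_def)

lemma act_free_add: "act_free g (f + f') = act_free g f + act_free g f'"
  by (rule poly_mapping_eqI) (simp add: lookup_act_free lookup_add algebra_simps)

lemma act_free_zero [simp]: "act_free g 0 = 0"
  by (rule poly_mapping_eqI) (simp add: lookup_act_free)

lemma act_free_uminus: "act_free g (- f) = - act_free g f"
  by (rule poly_mapping_eqI) (simp add: lookup_act_free)

lemma act_free_diff: "act_free g (f - f') = act_free g f - act_free g f'"
  by (rule poly_mapping_eqI) (simp add: lookup_act_free lookup_minus algebra_simps)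

lemma act_free_mult: "act_free g (f * f') = act_free g f * act_free g f'"
proof (induction f rule: free_induct)
  case (single w c)
  show ?case
    by (induction f' rule: free_induct)
      (simp_all add: act_free_single act_free_add mult_single plus_word_def algebra_simps)
qed (simp_all add: act_free_add algebra_simps)

lemma act_free_const [simp]: "act_free g (const c) = const c"
  by (simp add: const_def act_free_single zero_word_def)

lemma act_free_one [simp]: "act_free g 1 = 1"
  using act_free_const[of g 1] by (simp add: const_def)

lemma gen_sign_squared: "gen_sign g i * gen_sign g i = 1"
  by (auto simp: gen_sign_def sgn_if_def)

lemma act_free_involutive: "act_free g (act_free g f) = f"
proof (rule poly_mapping_eqI)
  fix w
  have "prod_list (map (gen_sign g) l) * prod_list (map (gen_sign g) l) = (1::'a)" for l
  proof (induction l)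
    case (Cons i l)
    have "gen_sign g i * prod_list (map (gen_sign g) l) * (gen_sign g i * prod_list (map (gen_sign g) l))
       = (gen_sign g i * gen_sign g i) * (prod_list (map (gen_sign g) l) * prod_list (map (gen_sign g) l)::'a)"
      by (simp only: mult_ac)
    then show ?case using Cons by (simp add: gen_sign_squared)
  qed simp
  then show "Poly_Mapping.lookup (act_free g (act_free g f)) w = Poly_Mapping.lookup f w"
    by (simp add: lookup_act_free flip: mult.assoc)
qed

lemma act_free_ring_hom: "act_free g \<in> ring_hom free_algebra free_algebra"
  by (rule ring_hom_memI) (simp_all add: act_free_add act_free_mult)

lemma act_free_var: "act_free g (var i) = (if gen_sign g i = (1::'k::field) then var i else - (var i :: 'k free))"
proof -
  have "gen_sign g i = (1::'k) \<or> gen_sign g i = (-1::'k)"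
    by (auto simp: gen_sign_def sgn_if_def)
  then show ?thesis by (auto simp: var_def act_free_single single_uminus)
qed

lemma comm_uminus [simp]: "comm (- a) b = - comm a b" "comm a (- b) = - comm a b"
  by (simp_all add: comm_def)

lemma anticomm_uminus [simp]: "anticomm (- a) b = - anticomm a b" "anticomm a (- b) = - anticomm a b"
  by (simp_all add: anticomm_def)

lemma act_free_comm: "act_free g (comm f f') = comm (act_free g f) (act_free g f')"
  by (simp add: comm_def act_free_diff act_free_mult)

lemma act_free_anticomm: "act_free g (anticomm f f') = anticomm (act_free g f) (act_free g f')"
  by (simp add: anticomm_def act_free_add act_free_mult)

text \<open>The generator \<open>X0\<close> is fixed and the signs on \<open>X1\<close>,
  \<open>X2\<close>, \<open>X3\<close> have product 1. Each relation combines products of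
  \<open>X0\<close> and one other generator with products of the remaining two, so all its terms
  change by the same sign.\<close>

lemma act_free_sklyanin_rels:
  fixes \<alpha> :: "'k::field"
  assumes "r \<in> sklyanin_rels \<alpha> \<beta> \<gamma>"
  shows "act_free g r = r \<or> act_free g r = - r"
proof -
  have neg: "- x - z * - y = - (x - z * y)" "- x - - y = - (x - y)" for x y z :: "'k free"
    by simp_all
  have "\<exists>s1 s2 s3. act_free g (var X0 :: 'k free) = var X0 \<and>
      act_free g (var X1) = (if s1 then - var X1 else var X1 :: 'k free) \<and>
      act_free g (var X2) = (if s2 then - var X2 else var X2 :: 'k free) \<and>
      act_free g (var X3) = (if s3 then - var X3 else var X3 :: 'k free) \<and> s3 = (s1 \<noteq> s2)"
    by (rule exI[of _ "snd g"], rule exI[of _ "fst g"], rule exI[of _ "snd g \<noteq> fst g"])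
      (auto simp: var_def act_free_single gen_sign_def sgn_if_def single_uminus)
  then obtain s1 s2 s3 where v: "act_free g (var X0 :: 'k free) = var X0"
      "act_free g (var X1) = (if s1 then - var X1 else var X1 :: 'k free)"
      "act_free g (var X2) = (if s2 then - var X2 else var X2 :: 'k free)"
      "act_free g (var X3) = (if s3 then - var X3 else var X3 :: 'k free)" and s3: "s3 = (s1 \<noteq> s2)"
    by auto
  show ?thesis
    using assms unfolding sklyanin_rels_def insert_iff empty_iff s3
    by (cases s1; cases s2; elim disjE)
      (simp_all only: s3 not_True_eq_False not_False_eq_True act_free_diff act_free_mult act_free_comm
        act_free_anticomm act_free_const v if_True if_False simp_thms comm_uminus anticomm_uminus minus_minus neg)
qed

lemma act_free_square: "act_free g (var i) * act_free g (var i) = var i * var i"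
  by (simp add: act_free_var)

section \<open>Passing the action to the Sklyanin algebra and to \<open>B\<close>\<close>

context
  fixes \<alpha> \<beta> \<gamma> :: "'k::field"
begin

lemma ideal_sklyanin: "ideal (sklyanin_ideal \<alpha> \<beta> \<gamma>) free_algebra"
  unfolding sklyanin_ideal_def by (rule ring.genideal_ideal[OF ring_free_algebra]) simp

lemma act_free_sklyanin_ideal: "act_free g ` sklyanin_ideal \<alpha> \<beta> \<gamma> = sklyanin_ideal \<alpha> \<beta> \<gamma>"
  unfolding sklyanin_ideal_def
proof (rule image_genideal[OF ring_free_algebra act_free_ring_hom])
  interpret ideal "sklyanin_ideal \<alpha> \<beta> \<gamma>" free_algebra by (rule ideal_sklyanin)
  have "- r \<in> sklyanin_ideal \<alpha> \<beta> \<gamma>" if "r \<in> sklyanin_ideal \<alpha> \<beta> \<gamma>" for r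
    using I_l_closed[OF that, of "- 1"] by simp
  moreover have "sklyanin_rels \<alpha> \<beta> \<gamma> \<subseteq> sklyanin_ideal \<alpha> \<beta> \<gamma>"
    unfolding sklyanin_ideal_def by (rule ring.genideal_self[OF ring_free_algebra]) simp
  ultimately have "act_free g r \<in> sklyanin_ideal \<alpha> \<beta> \<gamma>" if "r \<in> sklyanin_rels \<alpha> \<beta> \<gamma>" for r
    using act_free_sklyanin_rels[OF that, of g] that by auto
  then show "act_free g ` sklyanin_rels \<alpha> \<beta> \<gamma> \<subseteq> Idl\<^bsub>free_algebra\<^esub> (sklyanin_rels \<alpha> \<beta> \<gamma>)"
    unfolding sklyanin_ideal_def by (rule image_subsetI)
qed (simp_all add: act_free_involutive)

lemma ring_sklyanin: "ring (sklyanin \<alpha> \<beta> \<gamma>)"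
  unfolding sklyanin_def by (rule ring_quot_algebra[OF ideal_sklyanin])

lemma carrier_sklyanin: "carrier (sklyanin \<alpha> \<beta> \<gamma>) = range (to_sklyanin \<alpha> \<beta> \<gamma>)"
  unfolding sklyanin_def carrier_quot_algebra by (simp add: to_sklyanin_def)

lemma to_sklyanin_ring_hom: "to_sklyanin \<alpha> \<beta> \<gamma> \<in> ring_hom free_algebra (sklyanin \<alpha> \<beta> \<gamma>)"
  using quot_algebra_ring_hom[OF ideal_sklyanin] unfolding sklyanin_def to_sklyanin_def .

lemma act_A_to_sklyanin: "act_A g (to_sklyanin \<alpha> \<beta> \<gamma> f) = to_sklyanin \<alpha> \<beta> \<gamma> (act_free g f)"
  unfolding act_A_def to_sklyanin_def
  by (rule image_coset[OF ring_free_algebra act_free_ring_hom act_free_sklyanin_ideal]) simp_all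

lemma to_sklyanin_add: "to_sklyanin \<alpha> \<beta> \<gamma> f \<oplus>\<^bsub>sklyanin \<alpha> \<beta> \<gamma>\<^esub> to_sklyanin \<alpha> \<beta> \<gamma> f' = to_sklyanin \<alpha> \<beta> \<gamma> (f + f')"
  and to_sklyanin_mult: "to_sklyanin \<alpha> \<beta> \<gamma> f \<otimes>\<^bsub>sklyanin \<alpha> \<beta> \<gamma>\<^esub> to_sklyanin \<alpha> \<beta> \<gamma> f' = to_sklyanin \<alpha> \<beta> \<gamma> (f * f')"
  and one_sklyanin: "\<one>\<^bsub>sklyanin \<alpha> \<beta> \<gamma>\<^esub> = to_sklyanin \<alpha> \<beta> \<gamma> 1"
  using ring_hom_memE(2,3)[OF to_sklyanin_ring_hom, of f f'] ring_hom_memE(4)[OF to_sklyanin_ring_hom]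
  by simp_all

lemma act_A_ring_hom: "act_A g \<in> ring_hom (sklyanin \<alpha> \<beta> \<gamma>) (sklyanin \<alpha> \<beta> \<gamma>)"
proof (rule ring_hom_memI)
  fix x y assume "x \<in> carrier (sklyanin \<alpha> \<beta> \<gamma>)" "y \<in> carrier (sklyanin \<alpha> \<beta> \<gamma>)"
  then obtain f f' where f: "x = to_sklyanin \<alpha> \<beta> \<gamma> f" "y = to_sklyanin \<alpha> \<beta> \<gamma> f'"
    unfolding carrier_sklyanin by blast
  show "act_A g (x \<otimes>\<^bsub>sklyanin \<alpha> \<beta> \<gamma>\<^esub> y) = act_A g x \<otimes>\<^bsub>sklyanin \<alpha> \<beta> \<gamma>\<^esub> act_A g y"
    unfolding f to_sklyanin_mult act_A_to_sklyanin act_free_mult ..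
  show "act_A g (x \<oplus>\<^bsub>sklyanin \<alpha> \<beta> \<gamma>\<^esub> y) = act_A g x \<oplus>\<^bsub>sklyanin \<alpha> \<beta> \<gamma>\<^esub> act_A g y"
    unfolding f to_sklyanin_add act_A_to_sklyanin act_free_add ..
qed (auto simp: carrier_sklyanin one_sklyanin act_A_to_sklyanin)

definition omega_ideal :: "'k free set set" where
  "omega_ideal = Idl\<^bsub>sklyanin \<alpha> \<beta> \<gamma>\<^esub> {Omega1 \<alpha> \<beta> \<gamma>, Omega2 \<alpha> \<beta> \<gamma>}"

text \<open>Invariance holds because both central elements are combinations of squares of
  generators, which no sign change affects.\<close>

lemma ideal_omega: "ideal omega_ideal (sklyanin \<alpha> \<beta> \<gamma>)"
  and Omega1_in_omega_ideal: "Omega1 \<alpha> \<beta> \<gamma> \<in> omega_ideal"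
  and act_A_omega_ideal: "act_A g ` omega_ideal = omega_ideal"
proof -
  have sub: "{Omega1 \<alpha> \<beta> \<gamma>, Omega2 \<alpha> \<beta> \<gamma>} \<subseteq> carrier (sklyanin \<alpha> \<beta> \<gamma>)"
    by (auto simp: carrier_sklyanin Omega1_def Omega2_def)
  show "ideal omega_ideal (sklyanin \<alpha> \<beta> \<gamma>)"
    unfolding omega_ideal_def by (rule ring.genideal_ideal[OF ring_sklyanin sub])
  have gen: "{Omega1 \<alpha> \<beta> \<gamma>, Omega2 \<alpha> \<beta> \<gamma>} \<subseteq> omega_ideal"
    unfolding omega_ideal_def by (rule ring.genideal_self[OF ring_sklyanin sub])
  then show "Omega1 \<alpha> \<beta> \<gamma> \<in> omega_ideal" by simp
  have "act_A g (Omega1 \<alpha> \<beta> \<gamma>) = Omega1 \<alpha> \<beta> \<gamma>" "act_A g (Omega2 \<alpha> \<beta> \<gamma>) = Omega2 \<alpha> \<beta> \<gamma>"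
    unfolding Omega1_def Omega2_def act_A_to_sklyanin
    by (simp_all add: act_free_add act_free_diff act_free_uminus act_free_mult act_free_square power2_eq_square)
  then show "act_A g ` omega_ideal = omega_ideal"
    unfolding omega_ideal_def using gen
    by (intro image_genideal[OF ring_sklyanin act_A_ring_hom _ sub])
      (auto simp: carrier_sklyanin act_A_to_sklyanin act_free_involutive omega_ideal_def)
qed

text \<open>The composite of the two quotient maps. It allows computing in \<open>B\<close>, whose
  elements are sets of cosets, with representatives in the free algebra.\<close>

definition to_B :: "'k free \<Rightarrow> 'k free set set" where
  "to_B f = omega_ideal +>\<^bsub>sklyanin \<alpha> \<beta> \<gamma>\<^esub> to_sklyanin \<alpha> \<beta> \<gamma> f"

lemma algebra_B_eq: "algebra_B \<alpha> \<beta> \<gamma> = quot_algebra (sklyanin \<alpha> \<beta> \<gamma>) omega_ideal"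
  by (simp add: algebra_B_def omega_ideal_def)

lemma ring_B: "ring (algebra_B \<alpha> \<beta> \<gamma>)"
  unfolding algebra_B_eq by (rule ring_quot_algebra[OF ideal_omega])

lemma to_B_ring_hom: "to_B \<in> ring_hom free_algebra (algebra_B \<alpha> \<beta> \<gamma>)"
  using ring_hom_trans[OF to_sklyanin_ring_hom quot_algebra_ring_hom[OF ideal_omega]]
  by (simp add: to_B_def[abs_def] algebra_B_eq o_def)

lemma carrier_B: "carrier (algebra_B \<alpha> \<beta> \<gamma>) = range to_B"
  unfolding algebra_B_eq carrier_quot_algebra by (auto simp: to_B_def carrier_sklyanin)

lemma scal_B: "scal (algebra_B \<alpha> \<beta> \<gamma>) c = to_B (const c)"
  by (simp add: algebra_B_eq to_B_def sklyanin_def to_sklyanin_def)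

lemma piece_B: "piece (algebra_B \<alpha> \<beta> \<gamma>) n = to_B ` piece free_algebra n"
  by (simp add: algebra_B_eq to_B_def sklyanin_def to_sklyanin_def image_image)

lemma act_B_to_B: "act_B g (to_B f) = to_B (act_free g f)"
proof -
  interpret ideal omega_ideal "sklyanin \<alpha> \<beta> \<gamma>" by (rule ideal_omega)
  show ?thesis
    unfolding act_B_def to_B_def
    by (simp add: image_coset[OF ring_sklyanin act_A_ring_hom act_A_omega_ideal a_subset] carrier_sklyanin act_A_to_sklyanin)
qed

lemma to_B_add: "to_B f \<oplus>\<^bsub>algebra_B \<alpha> \<beta> \<gamma>\<^esub> to_B f' = to_B (f + f')"
  and to_B_mult: "to_B f \<otimes>\<^bsub>algebra_B \<alpha> \<beta> \<gamma>\<^esub> to_B f' = to_B (f * f')"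
  and one_B: "\<one>\<^bsub>algebra_B \<alpha> \<beta> \<gamma>\<^esub> = to_B 1"
  and zero_B: "\<zero>\<^bsub>algebra_B \<alpha> \<beta> \<gamma>\<^esub> = to_B 0"
proof -
  interpret ring_hom_ring free_algebra "algebra_B \<alpha> \<beta> \<gamma>" to_B
    by (intro ring_hom_ringI2 ring_free_algebra ring_B to_B_ring_hom)
  show "to_B f \<oplus>\<^bsub>algebra_B \<alpha> \<beta> \<gamma>\<^esub> to_B f' = to_B (f + f')" using hom_add[of f f'] by simp
  show "to_B f \<otimes>\<^bsub>algebra_B \<alpha> \<beta> \<gamma>\<^esub> to_B f' = to_B (f * f')" using hom_mult[of f f'] by simp
  show "\<one>\<^bsub>algebra_B \<alpha> \<beta> \<gamma>\<^esub> = to_B 1" using hom_one by simp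
  show "\<zero>\<^bsub>algebra_B \<alpha> \<beta> \<gamma>\<^esub> = to_B 0" using hom_zero by simp
qed

lemma to_B_relation:
  assumes "r \<in> sklyanin_rels \<alpha> \<beta> \<gamma>"
  shows "to_B r = to_B 0"
proof -
  interpret I: ideal "sklyanin_ideal \<alpha> \<beta> \<gamma>" free_algebra by (rule ideal_sklyanin)
  have "sklyanin_rels \<alpha> \<beta> \<gamma> \<subseteq> sklyanin_ideal \<alpha> \<beta> \<gamma>"
    unfolding sklyanin_ideal_def by (rule ring.genideal_self[OF ring_free_algebra]) simp
  then have "r \<in> sklyanin_ideal \<alpha> \<beta> \<gamma>" using assms by (rule subsetD)
  then have "to_sklyanin \<alpha> \<beta> \<gamma> r = sklyanin_ideal \<alpha> \<beta> \<gamma>"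
    unfolding to_sklyanin_def by (rule I.a_rcos_const)
  moreover have "to_sklyanin \<alpha> \<beta> \<gamma> 0 = sklyanin_ideal \<alpha> \<beta> \<gamma>"
    unfolding to_sklyanin_def using additive_subgroup.zero_closed[OF ideal.axioms(1)[OF ideal_sklyanin]]
    by (intro I.a_rcos_const) simp
  ultimately show ?thesis unfolding to_B_def by (simp only:)
qed

lemma to_B_Omega1: "to_B (- (var X0)\<^sup>2 + (var X1)\<^sup>2 + (var X2)\<^sup>2 + (var X3)\<^sup>2) = to_B 0"
proof -
  interpret J: ideal omega_ideal "sklyanin \<alpha> \<beta> \<gamma>" by (rule ideal_omega)
  have "to_B (- (var X0)\<^sup>2 + (var X1)\<^sup>2 + (var X2)\<^sup>2 + (var X3)\<^sup>2) = omega_ideal"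
    unfolding to_B_def Omega1_def[symmetric]
    by (rule J.a_rcos_const[OF Omega1_in_omega_ideal])
  also have "\<dots> = to_B 0" using zero_B unfolding algebra_B_eq quot_algebra_simps .
  finally show ?thesis .
qed

end

section \<open>The cocycle twist\<close>

definition klein_add :: "klein \<Rightarrow> klein \<Rightarrow> klein" where
  "klein_add g h = (fst g \<noteq> fst h, snd g \<noteq> snd h)"

fun gen_deg :: "gen \<Rightarrow> klein" where
  "gen_deg X0 = (False, False)"
| "gen_deg X1 = (True, False)"
| "gen_deg X2 = (False, True)"
| "gen_deg X3 = (True, True)"

definition word_deg :: "word \<Rightarrow> klein" where
  "word_deg w = foldr (\<lambda>i. klein_add (gen_deg i)) (letters w) (False, False)"

lemma klein_char_add: "klein_char (klein_add g g') h = klein_char g h * klein_char g' h"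
  by (simp add: klein_char_def klein_add_def sgn_if_def)

lemma gen_sign_eq_klein_char: "gen_sign h i = klein_char (gen_deg i) h"
  by (cases i) (auto simp: gen_sign_def klein_char_def sgn_if_def)

lemma act_free_single_word:
  fixes c :: "'k::field"
  shows "act_free h (Poly_Mapping.single w c) = Poly_Mapping.single w (klein_char (word_deg w) h * c)"
proof -
  have "prod_list (map (gen_sign h) l) = (klein_char (foldr (\<lambda>i. klein_add (gen_deg i)) l (False, False)) h :: 'k)" for l
    by (induction l) (simp_all add: klein_char_add gen_sign_eq_klein_char, simp add: klein_char_def sgn_if_def)
  then show ?thesis by (simp add: act_free_single word_deg_def)
qed

lemma klein_char_orthogonal:
  "(\<Sum>h\<in>UNIV. klein_char g h * klein_char g' h) = (if g = g' then 4 else (0::'k::field))"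
proof -
  have U: "(UNIV :: klein set) = {(False, False), (False, True), (True, False), (True, True)}" by auto
  have "(\<Sum>h\<in>UNIV. F h) = F (False, False) + F (False, True) + F (True, False) + F (True, True)"
    for F :: "klein \<Rightarrow> 'k"
    unfolding U by (simp add: add.assoc)
  then show ?thesis
    by (cases "fst g"; cases "snd g"; cases "fst g'"; cases "snd g'")
      (simp_all add: klein_char_def sgn_if_def prod_eq_iff del: sum_constant)
qed

text \<open>The usual averaging formula for the projection onto the isotypic part of a character; no
  inverse appears because the characters take values 1 and -1. It is defined on representatives and
  descends to \<open>B\<close>.\<close>

definition klein_proj :: "klein \<Rightarrow> 'k::field free \<Rightarrow> 'k free" where
  "klein_proj g f = const (1 / 4) * (\<Sum>h\<in>UNIV. const (klein_char g h) * act_free h f)"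

lemma klein_proj_add: "klein_proj g (f + f') = klein_proj g f + klein_proj g f'"
  by (simp add: klein_proj_def act_free_add sum.distrib algebra_simps)

lemma klein_proj_sum: "klein_proj g (sum f S) = (\<Sum>i\<in>S. klein_proj g (f i))"
  by (induction S rule: infinite_finite_induct) (simp_all add: klein_proj_add, simp_all add: klein_proj_def)

lemma const_mult: "const (a * b) = const a * const b"
  by (simp add: const_def mult_single)

lemma const_add: "const (a + b) = const a + const b"
  by (simp add: const_def single_add)

lemma const_zero [simp]: "const 0 = 0"
  by (simp add: const_def)

lemma const_one [simp]: "const 1 = 1"
  by (simp add: const_def)

lemma const_sum: "const (sum f S) = (\<Sum>i\<in>S. const (f i))"
  by (induction S rule: infinite_finite_induct) (simp_all add: const_add)

section \<open>Homogeneous components in \<open>B\<close> and the twisted product\<close>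

context
  fixes \<alpha> \<beta> \<gamma> :: "'k::field"
begin

abbreviation "cls \<equiv> to_B \<alpha> \<beta> \<gamma>"

lemma cls_cong_add: "cls f = cls f' \<Longrightarrow> cls g = cls g' \<Longrightarrow> cls (f + g) = cls (f' + g')"
  by (simp flip: to_B_add)

lemma cls_cong_mult: "cls f = cls f' \<Longrightarrow> cls g = cls g' \<Longrightarrow> cls (f * g) = cls (f' * g')"
  by (simp flip: to_B_mult)

lemma cls_cong_sum: "(\<And>i. i \<in> S \<Longrightarrow> cls (f i) = cls (g i)) \<Longrightarrow> cls (sum f S) = cls (sum g S)"
proof (induction S rule: infinite_finite_induct)
  case (insert x F)
  then have "cls (f x + sum f F) = cls (g x + sum g F)"
    by (intro cls_cong_add) simp_all
  then show ?case using insert.hyps by simp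
qed simp_all

lemma cls_cong_act_free: "cls f = cls f' \<Longrightarrow> cls (act_free h f) = cls (act_free h f')"
  by (simp flip: act_B_to_B)

lemma cls_cong_klein_proj: "cls f = cls f' \<Longrightarrow> cls (klein_proj g f) = cls (klein_proj g f')"
  unfolding klein_proj_def by (intro cls_cong_mult cls_cong_sum cls_cong_act_free refl)

lemma mem_G_piece_iff:
  "cls f \<in> G_piece \<alpha> \<beta> \<gamma> g \<longleftrightarrow> (\<forall>h. cls (act_free h f) = cls (const (klein_char g h) * f))"
  by (simp add: G_piece_def carrier_B act_B_to_B scal_B to_B_mult)

lemma klein_proj_G_piece:
  assumes "(2::'k) \<noteq> 0" "cls f \<in> G_piece \<alpha> \<beta> \<gamma> g'"
  shows "cls (klein_proj g f) = cls (if g = g' then f else 0)"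
proof -
  have four: "(4::'k) \<noteq> 0"
    using assms(1) by (metis mult_2 mult_eq_0_iff numeral_Bit0 one_add_one)
  have "cls (klein_proj g f) = cls (const (1 / 4) * (\<Sum>h\<in>UNIV. const (klein_char g h) * (const (klein_char g' h) * f)))"
    unfolding klein_proj_def
    by (intro cls_cong_mult cls_cong_sum refl) (rule assms(2)[unfolded mem_G_piece_iff, rule_format])
  also have "const (1 / 4) * (\<Sum>h\<in>UNIV. const (klein_char g h) * (const (klein_char g' h) * f))
     = const (1 / 4 * (\<Sum>h\<in>UNIV. klein_char g h * klein_char g' h)) * f"
    by (simp only: const_mult const_sum sum_distrib_right mult.assoc)
  also have "\<dots> = (if g = g' then f else 0)"
    using four by (simp add: klein_char_orthogonal)
  finally show ?thesis .
qed

lemma finsum_cls: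
  assumes "finite S"
  shows "finsum (algebra_B \<alpha> \<beta> \<gamma>) (\<lambda>i. cls (f i)) S = cls (sum f S)"
proof -
  interpret B: ring "algebra_B \<alpha> \<beta> \<gamma>" by (rule ring_B)
  show ?thesis using assms
  proof induction
    case (insert x F)
    then show ?case by (subst B.finsum_insert) (auto simp: carrier_B to_B_add)
  qed (simp add: zero_B)
qed

lemma zero_mem_G_piece: "cls 0 \<in> G_piece \<alpha> \<beta> \<gamma> g"
  by (simp add: mem_G_piece_iff)

text \<open>\<open>component\<close> is a definite description, so both existence and uniqueness of
  the decomposition are required. For a homogeneous class existence is immediate. For uniqueness,
  \<open>klein_proj g\<close> applied to the sum of any other decomposition returns its part of
  degree \<open>g\<close>, by orthogonality of characters.\<close>

lemma component_G_piece:
  assumes two: "(2::'k) \<noteq> 0" and c0: "cls f \<in> G_piece \<alpha> \<beta> \<gamma> g0"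
  shows "component (algebra_B \<alpha> \<beta> \<gamma>) (G_piece \<alpha> \<beta> \<gamma>) g (cls f) = cls (if g = g0 then f else 0)"
proof -
  interpret B: ring "algebra_B \<alpha> \<beta> \<gamma>" by (rule ring_B)
  let ?B = "algebra_B \<alpha> \<beta> \<gamma>" and ?V = "G_piece \<alpha> \<beta> \<gamma>"
  let ?P = "\<lambda>c. (\<forall>j. c j \<in> ?V j) \<and> finite {j. c j \<noteq> \<zero>\<^bsub>?B\<^esub>} \<and> cls f = finsum ?B c {j. c j \<noteq> \<zero>\<^bsub>?B\<^esub>}"
  let ?w = "\<lambda>g. cls (if g = g0 then f else 0)"
  have sum_UNIV: "finsum ?B c {j. c j \<noteq> \<zero>\<^bsub>?B\<^esub>} = finsum ?B c UNIV" if "\<forall>j. c j \<in> carrier ?B" for c :: "klein \<Rightarrow> _"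
    using that by (intro B.add.finprod_mono_neutral_cong_left) auto
  have w: "?P ?w"
  proof (intro conjI)
    show "\<forall>j. ?w j \<in> ?V j" using c0 zero_mem_G_piece by auto
  qed (simp_all add: sum_UNIV carrier_B finsum_cls zero_B)
  moreover have "c = ?w" if c: "?P c" for c
  proof
    fix g
    have "\<exists>e. c j = cls e" for j
    proof -
      have "c j \<in> ?V j" using c by blast
      then show ?thesis by (auto simp: G_piece_def carrier_B)
    qed
    then obtain e where e: "\<And>j. c j = cls (e j)" by metis
    have "cls f = finsum ?B c UNIV"
      using c sum_UNIV[of c] by (auto simp: e carrier_B)
    also have "c = (\<lambda>j. cls (e j))" using e by (rule ext)
    also have "finsum ?B (\<lambda>j. cls (e j)) UNIV = cls (sum e UNIV)" by (rule finsum_cls) simp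
    finally have "cls f = cls (sum e UNIV)" .
    then have "cls (klein_proj g f) = cls (\<Sum>j\<in>UNIV. klein_proj g (e j))"
      using cls_cong_klein_proj by (metis klein_proj_sum)
    also have "\<dots> = cls (\<Sum>j\<in>UNIV. if g = j then e j else 0)"
      using c two by (intro cls_cong_sum klein_proj_G_piece) (auto simp: e)
    also have "\<dots> = c g" by (simp add: e)
    finally show "c g = ?w g" using klein_proj_G_piece[OF two c0] by simp
  qed
  ultimately have "(THE c. ?P c) = ?w" by (rule the_equality)
  then show ?thesis unfolding component_def by (rule fun_cong)
qed

lemma cls_single_mem_G_piece: "cls (Poly_Mapping.single w c) \<in> G_piece \<alpha> \<beta> \<gamma> (word_deg w)"
  by (simp add: mem_G_piece_iff act_free_single_word const_def mult_single)

text \<open>Words are homogeneous, so in the sum over pairs of degrees that defines the twisted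
  product only the pair of their own degrees contributes.\<close>

lemma B_twist_mult_words:
  assumes two: "(2::'k) \<noteq> 0"
  shows "cls (Poly_Mapping.single u a) \<otimes>\<^bsub>B_twist \<alpha> \<beta> \<gamma>\<^esub> cls (Poly_Mapping.single w b)
    = cls (Poly_Mapping.single (u + w) (cocycle (word_deg u) (word_deg w) * a * b))"
proof -
  let ?f = "\<lambda>(g, h). const (cocycle g h) * ((if g = word_deg u then Poly_Mapping.single u a else 0) *
     (if h = word_deg w then Poly_Mapping.single w b else 0))"
  have "cls (Poly_Mapping.single u a) \<otimes>\<^bsub>B_twist \<alpha> \<beta> \<gamma>\<^esub> cls (Poly_Mapping.single w b)
    = finsum (algebra_B \<alpha> \<beta> \<gamma>) (\<lambda>p. cls (?f p)) UNIV"
    by (simp add: B_twist_def cocycle_twist_def component_G_piece[OF two cls_single_mem_G_piece] scal_B to_B_mult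
      case_prod_unfold)
  also have "\<dots> = cls (sum ?f UNIV)" by (rule finsum_cls) simp
  also have "sum ?f UNIV = (\<Sum>p\<in>UNIV. if p = (word_deg u, word_deg w) then ?f p else 0)"
  proof (rule sum.cong)
    fix p :: "klein \<times> klein"
    show "?f p = (if p = (word_deg u, word_deg w) then ?f p else 0)"
      by (cases p; cases "fst p = word_deg u"; cases "snd p = word_deg w") simp_all
  qed simp
  also have "\<dots> = Poly_Mapping.single (u + w) (cocycle (word_deg u) (word_deg w) * a * b)"
    by (simp add: const_def mult_single mult.assoc)
  finally show ?thesis .
qed

end

section \<open>Point modules\<close>

lemma component_eqI:
  assumes "internal_direct_sum M V" "m \<in> carrier M"
    and "\<And>i. c i \<in> V i" "finite {i. c i \<noteq> \<zero>\<^bsub>M\<^esub>}" "m = finsum M c {i. c i \<noteq> \<zero>\<^bsub>M\<^esub>}"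
  shows "component M V i m = c i"
proof -
  have "(THE c. (\<forall>i. c i \<in> V i) \<and> finite {i. c i \<noteq> \<zero>\<^bsub>M\<^esub>} \<and> m = finsum M c {i. c i \<noteq> \<zero>\<^bsub>M\<^esub>}) = c"
    using assms unfolding internal_direct_sum_def by (intro the1_equality) auto
  then show ?thesis unfolding component_def by (rule fun_cong)
qed

lemma component_decomposition:
  assumes "internal_direct_sum M V" "m \<in> carrier M"
  shows "component M V i m \<in> V i"
    and "finite {i. component M V i m \<noteq> \<zero>\<^bsub>M\<^esub>}"
    and "m = finsum M (\<lambda>i. component M V i m) {i. component M V i m \<noteq> \<zero>\<^bsub>M\<^esub>}"
proof -
  obtain c where c: "\<And>i. c i \<in> V i" "finite {i. c i \<noteq> \<zero>\<^bsub>M\<^esub>}" "m = finsum M c {i. c i \<noteq> \<zero>\<^bsub>M\<^esub>}"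
    using assms unfolding internal_direct_sum_def by metis
  have "component M V i m = c i" for i by (rule component_eqI[OF assms c])
  then show "component M V i m \<in> V i"
    and "finite {i. component M V i m \<noteq> \<zero>\<^bsub>M\<^esub>}"
    and "m = finsum M (\<lambda>i. component M V i m) {i. component M V i m \<noteq> \<zero>\<^bsub>M\<^esub>}"
    using c by simp_all
qed

context
  fixes M :: "('m, 'z) ring_scheme" (structure) and V :: "'i \<Rightarrow> 'm set"
  assumes grp: "abelian_group M" and ds: "internal_direct_sum M V"
begin

interpretation abelian_group M by (rule grp)

lemma direct_summand_subgroup: "additive_subgroup (V i) M"
  using ds by (simp add: internal_direct_sum_def)

lemma direct_summand_closed: "v \<in> V i \<Longrightarrow> v \<in> carrier M"
  using additive_subgroup.a_Hcarr[OF direct_summand_subgroup] .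

lemma component_homogeneous:
  assumes "v \<in> V i"
  shows "component M V j v = (if j = i then v else \<zero>)"
proof (rule component_eqI[OF ds direct_summand_closed[OF assms]])
  let ?c = "\<lambda>j. if j = i then v else \<zero>"
  show "?c j \<in> V j" for j
    using assms additive_subgroup.zero_closed[OF direct_summand_subgroup] by simp
  have sub: "{j. ?c j \<noteq> \<zero>} \<subseteq> {i}" by auto
  then show "finite {j. ?c j \<noteq> \<zero>}" by (rule finite_subset) simp
  have "finsum M ?c {j. ?c j \<noteq> \<zero>} = finsum M ?c {i}"
    using sub direct_summand_closed[OF assms] by (intro add.finprod_mono_neutral_cong_left) auto
  then show "v = finsum M ?c {j. ?c j \<noteq> \<zero>}" using direct_summand_closed[OF assms] by simp
qed

lemma component_add:
  assumes m: "m \<in> carrier M" and m': "m' \<in> carrier M"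
  shows "component M V i (m \<oplus> m') = component M V i m \<oplus> component M V i m'"
proof (rule component_eqI[OF ds])
  note d = component_decomposition[OF ds m] and d' = component_decomposition[OF ds m']
  let ?c = "\<lambda>i. component M V i m" and ?c' = "\<lambda>i. component M V i m'"
  let ?S = "{i. ?c i \<noteq> \<zero>} \<union> {i. ?c' i \<noteq> \<zero>}"
  have cl: "?c i \<in> carrier M" "?c' i \<in> carrier M" for i
    using d(1) d'(1) direct_summand_closed by blast+
  have fin: "finite ?S" using d(2) d'(2) by simp
  show "m \<oplus> m' \<in> carrier M" using m m' by simp
  show "?c i \<oplus> ?c' i \<in> V i" for i
    using d(1) d'(1) by (intro additive_subgroup.a_closed[OF direct_summand_subgroup])
  have sub: "{i. ?c i \<oplus> ?c' i \<noteq> \<zero>} \<subseteq> ?S" by auto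
  then show "finite {i. ?c i \<oplus> ?c' i \<noteq> \<zero>}" using fin by (rule finite_subset)
  have "finsum M (\<lambda>i. ?c i \<oplus> ?c' i) {i. ?c i \<oplus> ?c' i \<noteq> \<zero>} = finsum M (\<lambda>i. ?c i \<oplus> ?c' i) ?S"
    using fin sub cl by (intro add.finprod_mono_neutral_cong_left) auto
  also have "\<dots> = finsum M ?c ?S \<oplus> finsum M ?c' ?S"
    using cl by (intro finsum_addf) auto
  also have "finsum M ?c ?S = finsum M ?c {i. ?c i \<noteq> \<zero>}"
    using fin cl by (intro add.finprod_mono_neutral_cong_right) auto
  also have "finsum M ?c' ?S = finsum M ?c' {i. ?c' i \<noteq> \<zero>}"
    using fin cl by (intro add.finprod_mono_neutral_cong_right) auto
  finally show "m \<oplus> m' = finsum M (\<lambda>i. ?c i \<oplus> ?c' i) {i. ?c i \<oplus> ?c' i \<noteq> \<zero>}"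
    using d(3) d'(3) by simp
qed

lemma direct_sum_induct [consumes 1, case_names zero homogeneous add]:
  assumes m: "m \<in> carrier M" and zero: "P \<zero>" and hom: "\<And>i v. v \<in> V i \<Longrightarrow> P v"
    and add: "\<And>x y. x \<in> carrier M \<Longrightarrow> y \<in> carrier M \<Longrightarrow> P x \<Longrightarrow> P y \<Longrightarrow> P (x \<oplus> y)"
  shows "P m"
proof -
  note d = component_decomposition[OF ds m]
  have "P (finsum M (\<lambda>i. component M V i m) S)" if "finite S" for S
    using that
  proof induction
    case (insert x F)
    have cl: "component M V i m \<in> carrier M" for i using d(1) direct_summand_closed by blast
    have "P (component M V x m \<oplus> finsum M (\<lambda>i. component M V i m) F)"
      using cl d(1) hom insert.IH by (intro add) auto
    then show ?case using insert.hyps cl by (subst finsum_insert) auto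
  qed (simp add: zero)
  then show ?thesis using d(2,3) by metis
qed

end

lemma hilbert_series_point: "fps_nth (1 / (1 - fps_X)) n = (1 :: rat)"
proof -
  have "(1 - fps_X) * Abs_fps (\<lambda>_. 1) = (1 :: rat fps)"
    by (rule fps_ext) (simp add: algebra_simps fps_X_mult_nth)
  then have "1 / (1 - fps_X) = (Abs_fps (\<lambda>_. 1) :: rat fps)"
    by (metis nonzero_mult_div_cancel_left mult_zero_left zero_neq_one)
  then show ?thesis by simp
qed

section \<open>The action of the twist on a graded module\<close>

context
  fixes \<alpha> \<beta> \<gamma> :: "'k::field" and M :: "('k free set set, 'm) graded_rmodule" (structure)
  assumes two: "(2::'k) \<noteq> 0" and graded: "graded_right_module (B_twist \<alpha> \<beta> \<gamma>) M"
begin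

text \<open>The action through representatives in the free algebra. It is additive in
  \<open>f\<close>, but acting by two words in turn is acting by their concatenation only up to the
  cocycle sign.\<close>

definition word_act :: "'m \<Rightarrow> 'k free \<Rightarrow> 'm" where
  "word_act m f = m \<odot> to_B \<alpha> \<beta> \<gamma> f"

lemma abelian_M: "abelian_group M" and ds_M: "internal_direct_sum M (mpiece M)"
  using graded by (simp_all add: graded_right_module_def)

interpretation abelian_group M by (rule abelian_M)

lemma B_twist_simps:
  "carrier (B_twist \<alpha> \<beta> \<gamma>) = range (to_B \<alpha> \<beta> \<gamma>)"
  "add (B_twist \<alpha> \<beta> \<gamma>) = add (algebra_B \<alpha> \<beta> \<gamma>)"
  "one (B_twist \<alpha> \<beta> \<gamma>) = to_B \<alpha> \<beta> \<gamma> 1"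
  "piece (B_twist \<alpha> \<beta> \<gamma>) n = to_B \<alpha> \<beta> \<gamma> ` piece free_algebra n"
  "scal (B_twist \<alpha> \<beta> \<gamma>) c = to_B \<alpha> \<beta> \<gamma> (const c)"
  using carrier_B one_B piece_B scal_B by (simp_all add: B_twist_def cocycle_twist_def)

lemma word_act_closed [simp]: "m \<in> carrier M \<Longrightarrow> word_act m f \<in> carrier M"
  using graded by (simp add: graded_right_module_def word_act_def B_twist_simps)

lemma word_act_add_left:
  "m \<in> carrier M \<Longrightarrow> m' \<in> carrier M \<Longrightarrow> word_act (m \<oplus> m') f = word_act m f \<oplus> word_act m' f"
  using graded by (simp add: graded_right_module_def word_act_def B_twist_simps)

lemma word_act_add_right:
  "m \<in> carrier M \<Longrightarrow> word_act m (f + f') = word_act m f \<oplus> word_act m f'"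
  using graded by (simp add: graded_right_module_def word_act_def B_twist_simps flip: to_B_add)

lemma word_act_zero_left [simp]: "word_act \<zero> f = \<zero>"
  using word_act_add_left[of \<zero> \<zero> f] word_act_closed[of \<zero> f] by (simp add: add.l_cancel_one')

lemma word_act_zero_right [simp]: "m \<in> carrier M \<Longrightarrow> word_act m 0 = \<zero>"
  using word_act_add_right[of m 0 0] word_act_closed[of m 0] by (simp add: add.l_cancel_one')

lemma word_act_mult:
  assumes "m \<in> carrier M"
  shows "word_act (word_act m (Poly_Mapping.single u a)) (Poly_Mapping.single w b)
    = word_act m (Poly_Mapping.single (u + w) (cocycle (word_deg u) (word_deg w) * a * b))"
proof -
  have "m \<odot> (to_B \<alpha> \<beta> \<gamma> x \<otimes>\<^bsub>B_twist \<alpha> \<beta> \<gamma>\<^esub> to_B \<alpha> \<beta> \<gamma> y)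
    = (m \<odot> to_B \<alpha> \<beta> \<gamma> x) \<odot> to_B \<alpha> \<beta> \<gamma> y" for x y
    using graded assms by (simp add: graded_right_module_def B_twist_simps)
  then show ?thesis by (simp add: word_act_def flip: B_twist_mult_words[OF two])
qed

text \<open>The empty word has trivial degree, where the cocycle is 1; together with the next lemma
  this lets scalars move past words without a sign.\<close>

lemma word_act_const_left:
  "m \<in> carrier M \<Longrightarrow> word_act (word_act m (const a)) (Poly_Mapping.single w b) = word_act m (Poly_Mapping.single w (a * b))"
  unfolding const_def by (simp add: word_act_mult cocycle_def sgn_if_def word_deg_def zero_word_def plus_word_def)

lemma word_act_const_right:
  "m \<in> carrier M \<Longrightarrow> word_act (word_act m (Poly_Mapping.single w b)) (const a) = word_act m (Poly_Mapping.single w (b * a))"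
  unfolding const_def by (simp add: word_act_mult cocycle_def sgn_if_def word_deg_def zero_word_def plus_word_def)

lemma word_act_const_const:
  "m \<in> carrier M \<Longrightarrow> word_act (word_act m (const a)) (const b) = word_act m (const (a * b))"
  using word_act_const_left[of m a 0 b] by (simp add: const_def)

lemma word_act_one: "m \<in> carrier M \<Longrightarrow> word_act m 1 = m"
  using graded by (simp add: graded_right_module_def word_act_def B_twist_simps)

lemma mpiece_closed: "v \<in> mpiece M n \<Longrightarrow> v \<in> carrier M"
  by (rule direct_summand_closed[OF abelian_M ds_M])

lemma zero_mpiece: "\<zero> \<in> mpiece M n"
  by (rule additive_subgroup.zero_closed[OF direct_summand_subgroup[OF abelian_M ds_M]])

lemma word_act_mpiece:
  assumes "v \<in> mpiece M n"
  shows "word_act v (Poly_Mapping.single w c) \<in> mpiece M (n + length (letters w))"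
proof -
  have "Poly_Mapping.single w c \<in> piece free_algebra (length (letters w))"
    by (simp add: free_algebra_def)
  then show ?thesis
    using graded assms unfolding graded_right_module_def word_act_def B_twist_simps by blast
qed

abbreviation "cmp \<equiv> component M (mpiece M)"

lemma cmp_mpiece: "m \<in> carrier M \<Longrightarrow> cmp n m \<in> mpiece M n"
  by (rule component_decomposition(1)[OF ds_M])

text \<open>A word raises degrees by its length, so nothing arrives in degrees below that length;
  the case distinction also guards the truncated subtraction.\<close>

lemma cmp_word_act:
  assumes "m \<in> carrier M"
  shows "cmp n (word_act m (Poly_Mapping.single w c)) =
    (if length (letters w) \<le> n then word_act (cmp (n - length (letters w)) m) (Poly_Mapping.single w c) else \<zero>)"
  using assms
proof (induction rule: direct_sum_induct[OF abelian_M ds_M, consumes 1, case_names zero homogeneous add])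
  case zero
  show ?case using component_homogeneous[OF abelian_M ds_M zero_mpiece] by simp
next
  case (homogeneous i v)
  show ?case
    using component_homogeneous[OF abelian_M ds_M word_act_mpiece[OF homogeneous]]
      component_homogeneous[OF abelian_M ds_M homogeneous] by auto
next
  case (add x y)
  then show ?case
    by (simp add: word_act_add_left component_add[OF abelian_M ds_M] mpiece_closed[OF cmp_mpiece])
qed

text \<open>A nonempty word reaching degree \<open>Suc n\<close> applies its last letter to an
  element of degree \<open>n\<close>, which gives zero, and no nonempty word reaches degree 0. In
  both degrees only the constant term of \<open>f\<close> survives.\<close>

lemma cmp_word_act_annihilated:
  assumes ann: "\<And>v i. v \<in> mpiece M n \<Longrightarrow> word_act v (var i) = \<zero>" and m: "m \<in> carrier M"
  shows "cmp (Suc n) (word_act m f) = word_act (cmp (Suc n) m) (const (Poly_Mapping.lookup f 0)) \<and>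
    cmp 0 (word_act m f) = word_act (cmp 0 m) (const (Poly_Mapping.lookup f 0))"
proof -
  have cl: "cmp k x \<in> carrier M" if "x \<in> carrier M" for k x using mpiece_closed[OF cmp_mpiece[OF that]] .
  note [simp] = cl[OF m]
  show ?thesis
  proof (induction f rule: free_induct)
    case zero
    then show ?case using m component_homogeneous[OF abelian_M ds_M zero_mpiece] by simp
  next
    case (single w c)
    show ?case
    proof (cases "letters w" rule: rev_cases)
      case Nil
      then have "w = 0" by (cases w) (simp add: zero_word_def)
      then show ?thesis using m Nil by (simp add: cmp_word_act const_def)
    next
      case (snoc l i)
      let ?u = "Word l"
      have w: "w = ?u + Word [i]" using snoc by (cases w) (simp add: plus_word_def)
      have w0: "w \<noteq> 0" using snoc by (auto simp: zero_word_def)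
      have act_zero: "word_act x (Poly_Mapping.single w c) = \<zero>" if x: "x \<in> mpiece M k" "k + length (letters w) = Suc n" for x k
      proof -
        \<comment> \<open>Acting by \<open>?u\<close> and then by the last letter produces the sign
          \<open>?s\<close>; scaling by \<open>?s\<close> beforehand cancels it.\<close>
        let ?s = "cocycle (word_deg ?u) (word_deg (Word [i])) :: 'k"
        have "?s * ?s = 1" by (simp add: cocycle_def sgn_if_def)
        then have "word_act (word_act x (Poly_Mapping.single ?u (?s * c))) (var i) = word_act x (Poly_Mapping.single w c)"
          unfolding var_def by (simp add: word_act_mult[OF mpiece_closed[OF x(1)]] w flip: mult.assoc)
        moreover have "word_act x (Poly_Mapping.single ?u (?s * c)) \<in> mpiece M n"
          using word_act_mpiece[OF x(1), of ?u] x(2) snoc by simp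
        ultimately show ?thesis using ann by simp
      qed
      \<comment> \<open>Since \<open>w\<close> has one letter more than \<open>l\<close>, the degree
        from which \<open>w\<close> leads to \<open>Suc n\<close> is
        \<open>n - length l\<close>.\<close>
      show ?thesis
        using m w0 snoc act_zero[OF cmp_mpiece[OF m, of "n - length l"]]
        by (simp add: cmp_word_act lookup_single_not_eq)
    qed
  next
    case (add f g)
    then show ?case
      using m by (simp add: word_act_add_right component_add[OF abelian_M ds_M] lookup_add const_add)
  qed
qed

section \<open>Consequences of the Hilbert series and of cyclicity\<close>

lemma piece_basis:
  assumes "has_hilbert_series (B_twist \<alpha> \<beta> \<gamma>) M (1 / (1 - fps_X))"
  shows "\<exists>e\<in>mpiece M n. (\<forall>v\<in>mpiece M n. \<exists>c. v = word_act e (const c)) \<and>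
    (\<forall>c. word_act e (const c) = \<zero> \<longrightarrow> c = 0)"
proof -
  obtain d where d: "has_kdim (B_twist \<alpha> \<beta> \<gamma>) M (mpiece M n) d" and "fps_nth (1 / (1 - fps_X)) n = (of_nat d :: rat)"
    using assms unfolding has_hilbert_series_def by blast
  then have "d = 1" by (simp add: hilbert_series_point)
  with d obtain b where b: "b 0 \<in> mpiece M n" and
    ex: "\<And>v. v \<in> mpiece M n \<Longrightarrow> \<exists>!c :: nat \<Rightarrow> 'k. (\<forall>i\<ge>1. c i = 0) \<and>
           v = finsum M (\<lambda>i. word_act (b i) (const (c i))) {..<1}"
    unfolding has_kdim_def B_twist_simps word_act_def by auto
  have fs: "finsum M (\<lambda>i. word_act (b i) (const (c i))) {..<1} = word_act (b 0) (const (c 0))" for c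
    using mpiece_closed[OF b] by (simp add: lessThan_Suc)
  let ?P = "\<lambda>v c. (\<forall>i\<ge>1. c i = 0) \<and> v = word_act (b 0) (const (c 0))"
  have ex1: "\<exists>!c :: nat \<Rightarrow> 'k. ?P v c" if "v \<in> mpiece M n" for v
    using ex[OF that] unfolding fs .
  show ?thesis
  proof (intro bexI[OF _ b] conjI ballI allI impI)
    show "\<exists>c. v = word_act (b 0) (const c)" if "v \<in> mpiece M n" for v
      using ex1[OF that] by blast
    show "c = 0" if "word_act (b 0) (const c) = \<zero>" for c
    proof -
      \<comment> \<open>This family and the zero family are both coordinates of zero, padded by 0
        beyond the dimension 1 as \<open>has_kdim\<close> demands, so they coincide.\<close>
      let ?c = "\<lambda>i :: nat. if i = 0 then c else 0"
      have "?P \<zero> ?c" "?P \<zero> (\<lambda>_. 0)" using that mpiece_closed[OF b] by simp_all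
      note this[THEN the1_equality[OF ex1[OF zero_mpiece]]]
      then have "?c = (\<lambda>_. 0)" by (rule trans[OF sym])
      from fun_cong[OF this, of 0] show ?thesis by simp
    qed
  qed
qed

text \<open>
  The generator \<open>m\<close> need not be homogeneous. If \<open>M\<^sub>n\<close> were killed by all \<open>x\<^sub>i\<close>, then for every \<open>f\<close> the components of
  \<open>m f\<close> in degrees \<open>0\<close> and \<open>n + 1\<close> would be those of \<open>m\<close> multiplied by the same scalar, the constant term of
  \<open>f\<close>, so that they could not be prescribed independently.
\<close>

lemma generated_in_degree_zero:
  assumes H: "has_hilbert_series (B_twist \<alpha> \<beta> \<gamma>) M (1 / (1 - fps_X))"
    and cyc: "cyclic_module (B_twist \<alpha> \<beta> \<gamma>) M"
  shows "\<exists>v\<in>mpiece M n. \<exists>i. word_act v (var i) \<noteq> \<zero>"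
proof (rule ccontr)
  assume "\<not> ?thesis"
  then have ann: "word_act v (var i) = \<zero>" if "v \<in> mpiece M n" for v i using that by blast
  obtain m where m: "m \<in> carrier M" and gen: "carrier M = {m \<odot> a | a. a \<in> range (to_B \<alpha> \<beta> \<gamma>)}"
    using cyc unfolding cyclic_module_def B_twist_simps by blast
  have gen: "\<exists>f. x = word_act m f" if "x \<in> carrier M" for x
    using that gen unfolding word_act_def by blast
  obtain e0 where e0: "e0 \<in> mpiece M 0" "\<And>v. v \<in> mpiece M 0 \<Longrightarrow> \<exists>c. v = word_act e0 (const c)"
    "\<And>c. word_act e0 (const c) = \<zero> \<Longrightarrow> c = 0" using piece_basis[OF H, of 0] by blast
  obtain e1 where e1: "e1 \<in> mpiece M (Suc n)" "\<And>c. word_act e1 (const c) = \<zero> \<Longrightarrow> c = 0"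
    using piece_basis[OF H, of "Suc n"] by blast
  note cl = mpiece_closed[OF e0(1)] mpiece_closed[OF e1(1)]
  obtain t where t: "cmp 0 m = word_act e0 (const t)" using e0(2) cmp_mpiece[OF m] by blast
  obtain f g where f: "e0 = word_act m f" and g: "e1 = word_act m g" using gen cl by blast
  let ?a = "Poly_Mapping.lookup f 0" and ?b = "Poly_Mapping.lookup g 0"
  \<comment> \<open>Comparing components in degree 0, \<open>e0 = m f\<close> forces
    \<open>t\<close> to be nonzero; \<open>e1 = m g\<close> has none there, so the constant term of
    \<open>g\<close> is zero. In degree \<open>Suc n\<close> this makes \<open>e1\<close> itself
    zero.\<close>
  have "e0 = word_act e0 (const (t * ?a))"
    using cmp_word_act_annihilated[OF ann m, where f = f] component_homogeneous[OF abelian_M ds_M e0(1), of 0]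
    by (simp add: t word_act_const_const cl flip: f)
  then have "t \<noteq> 0" using e0(3)[of 1] cl by (auto simp: word_act_one)
  moreover have "\<zero> = word_act e0 (const (t * ?b))"
    using cmp_word_act_annihilated[OF ann m, where f = g] component_homogeneous[OF abelian_M ds_M e1(1), of 0]
    by (simp add: t word_act_const_const cl flip: g)
  then have "t * ?b = 0" using e0(3) by metis
  moreover have "e1 = word_act (cmp (Suc n) m) (const ?b)"
    using cmp_word_act_annihilated[OF ann m, where f = g] component_homogeneous[OF abelian_M ds_M e1(1), of "Suc n"]
    by (simp flip: g)
  ultimately have "e1 = \<zero>" using mpiece_closed[OF cmp_mpiece[OF m]] by simp
  then show False using e1(2)[of 1] by simp
qed


section \<open>From quadratic relations to bilinear equations\<close>

lemma degree_two_action: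
  assumes e: "e0 \<in> carrier M" "e1 \<in> carrier M" "e2 \<in> carrier M"
    and p: "\<And>i. word_act e0 (var i) = word_act e1 (const (p i))"
    and q: "\<And>i. word_act e1 (var i) = word_act e2 (const (q i))"
  shows "word_act e0 (Poly_Mapping.single (Word [i, j]) c) =
    word_act e2 (const (cocycle (gen_deg i) (gen_deg j) * p i * q j * c))"
proof -
  let ?s = "cocycle (gen_deg i) (gen_deg j) :: 'k"
  have s: "?s * ?s = 1" by (simp add: cocycle_def sgn_if_def)
  have d: "word_deg (Word [i]) = gen_deg i" for i
    by (simp add: word_deg_def klein_add_def)
  \<comment> \<open>The untwisted monomial is \<open>?s\<close> times the twisted product of its two
    letters, as \<open>?s\<close> is its own inverse.\<close>
  have "word_act e0 (Poly_Mapping.single (Word [i, j]) c) =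
      word_act (word_act (word_act e0 (var i)) (const (?s * c))) (var j)"
    unfolding var_def using e s
    by (simp add: word_act_const_right word_act_mult d plus_word_def flip: mult.assoc)
  also have "\<dots> = word_act (word_act e1 (var j)) (const (p i * (?s * c)))"
    unfolding p using e by (simp add: word_act_const_const word_act_const_left word_act_const_right var_def)
  also have "\<dots> = word_act e2 (const (q j * (p i * (?s * c))))"
    using e by (simp add: q word_act_const_const)
  finally show ?thesis by (simp add: mult_ac)
qed

text \<open>A relation of \<open>B\<close> kills \<open>e0\<close>, and \<open>inj\<close> turns
  this into an equation between scalars. The quadratic form is given as a list of triples so that
  each concrete relation can be evaluated by simplification.\<close>

lemma quadratic_relation:
  assumes e: "e0 \<in> carrier M" "e1 \<in> carrier M" "e2 \<in> carrier M"
    and p: "\<And>i. word_act e0 (var i) = word_act e1 (const (p i))"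
    and q: "\<And>i. word_act e1 (var i) = word_act e2 (const (q i))"
    and inj: "\<And>c. word_act e2 (const c) = \<zero> \<Longrightarrow> c = 0"
    and r: "to_B \<alpha> \<beta> \<gamma> (\<Sum>(i, j, c)\<leftarrow>r. Poly_Mapping.single (Word [i, j]) c) = to_B \<alpha> \<beta> \<gamma> 0"
  shows "(\<Sum>(i, j, c)\<leftarrow>r. cocycle (gen_deg i) (gen_deg j) * p i * q j * c) = 0"
proof (rule inj)
  have "word_act e2 (const (\<Sum>(i, j, c)\<leftarrow>r. cocycle (gen_deg i) (gen_deg j) * p i * q j * c)) =
     word_act e0 (\<Sum>(i, j, c)\<leftarrow>r. Poly_Mapping.single (Word [i, j]) c)" for r
    by (induction r) (auto simp: e const_add word_act_add_right degree_two_action[OF e p q])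
  also have "word_act e0 (\<Sum>(i, j, c)\<leftarrow>r. Poly_Mapping.single (Word [i, j]) c) = \<zero>"
    using e r word_act_zero_right[of e0] by (simp add: word_act_def)
  finally show "word_act e2 (const (\<Sum>(i, j, c)\<leftarrow>r. cocycle (gen_deg i) (gen_deg j) * p i * q j * c)) = \<zero>" .
qed

lemma multiplication_coordinates:
  assumes H: "has_hilbert_series (B_twist \<alpha> \<beta> \<gamma>) M (1 / (1 - fps_X))"
    and cyc: "cyclic_module (B_twist \<alpha> \<beta> \<gamma>) M"
    and e: "e \<in> mpiece M n" "\<And>v. v \<in> mpiece M n \<Longrightarrow> \<exists>c. v = word_act e (const c)"
    and e': "e' \<in> mpiece M (Suc n)" "\<And>v. v \<in> mpiece M (Suc n) \<Longrightarrow> \<exists>c. v = word_act e' (const c)"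
  obtains p where "\<And>i. word_act e (var i) = word_act e' (const (p i))" "\<exists>i. p i \<noteq> 0"
proof -
  note cl = mpiece_closed[OF e(1)] mpiece_closed[OF e'(1)]
  have "\<exists>c. word_act e (var i) = word_act e' (const c)" for i
    using word_act_mpiece[OF e(1), of "Word [i]" 1] by (intro e'(2)) (simp add: var_def)
  then obtain p where p: "\<And>i. word_act e (var i) = word_act e' (const (p i))" by metis
  obtain v i where v: "v \<in> mpiece M n" "word_act v (var i) \<noteq> \<zero>"
    using generated_in_degree_zero[OF H cyc, of n] by blast
  obtain c where c: "v = word_act e (const c)" using e(2)[OF v(1)] by blast
  \<comment> \<open>Moving the scalar past the generator shows that \<open>v\<close> times the
    generator is a multiple of \<open>e\<close> times it, so the latter cannot vanish.\<close>
  have "word_act v (var i) = word_act (word_act e (var i)) (const c)"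
    using cl by (simp add: c var_def word_act_const_left word_act_const_right)
  then have "p i \<noteq> 0" using v(2) cl by (auto simp: p)
  with p show ?thesis by (intro that[of p] exI[of _ i])
qed


lemma not_point_module:
  assumes par: "sklyanin_params \<alpha> \<beta> \<gamma>"
  shows "\<not> point_module (B_twist \<alpha> \<beta> \<gamma>) M"
proof
  assume "point_module (B_twist \<alpha> \<beta> \<gamma>) M"
  then have H: "has_hilbert_series (B_twist \<alpha> \<beta> \<gamma>) M (1 / (1 - fps_X))"
    and cyc: "cyclic_module (B_twist \<alpha> \<beta> \<gamma>) M"
    by (simp_all add: point_module_def)
  obtain e where e: "\<And>n. e n \<in> mpiece M n" "\<And>n v. v \<in> mpiece M n \<Longrightarrow> \<exists>c. v = word_act (e n) (const c)"
    "\<And>n c. word_act (e n) (const c) = \<zero> \<Longrightarrow> c = 0"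
    using piece_basis[OF H] by metis
  obtain p where p: "\<And>i. word_act (e 0) (var i) = word_act (e 1) (const (p i))" and p_nz: "\<exists>i. p i \<noteq> 0"
    using multiplication_coordinates[OF H cyc e(1,2) e(1,2), of 0] unfolding One_nat_def by blast
  obtain q where q: "\<And>i. word_act (e 1) (var i) = word_act (e 2) (const (q i))" and q_nz: "\<exists>i. q i \<noteq> 0"
    using multiplication_coordinates[OF H cyc e(1,2) e(1,2), of 1] unfolding Suc_1 by blast
  have rel: "(\<Sum>(i, j, c)\<leftarrow>r. cocycle (gen_deg i) (gen_deg j) * p i * q j * c) = 0"
    if "to_B \<alpha> \<beta> \<gamma> (\<Sum>(i, j, c)\<leftarrow>r. Poly_Mapping.single (Word [i, j]) c) = to_B \<alpha> \<beta> \<gamma> 0" for r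
    by (rule quadratic_relation[OF mpiece_closed[OF e(1)] mpiece_closed[OF e(1)] mpiece_closed[OF e(1)] p q e(3) that])
  note word_simps = var_def const_def comm_def anticomm_def mult_single plus_word_def zero_word_def
    distrib_left single_uminus power2_eq_square
  have rel': "(\<Sum>(i, j, c)\<leftarrow>r. cocycle (gen_deg i) (gen_deg j) * p i * q j * c) = 0"
    if "(\<Sum>(i, j, c)\<leftarrow>r. Poly_Mapping.single (Word [i, j]) c) \<in> sklyanin_rels \<alpha> \<beta> \<gamma>" for r
    by (rule rel, rule to_B_relation[OF that])
  \<comment> \<open>Each list spells out one relation of \<open>B\<close>. The resulting equation
    differs from it by the cocycle, which is -1 exactly on the pairs (\<open>X1\<close>,
    \<open>X2\<close>), (\<open>X1\<close>, \<open>X3\<close>), (\<open>X3\<close>,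
    \<open>X2\<close>) and (\<open>X3\<close>, \<open>X3\<close>).\<close>
  have "p X0 * q X1 - p X1 * q X0 = \<alpha> * (p X2 * q X3 - p X3 * q X2)"
    using rel'[of "[(X0, X1, 1), (X1, X0, - 1), (X2, X3, - \<alpha>), (X3, X2, - \<alpha>)]"]
    by (simp add: sklyanin_rels_def word_simps cocycle_def sgn_if_def algebra_simps)
  moreover have "p X0 * q X1 + p X1 * q X0 = p X2 * q X3 + p X3 * q X2"
    using rel'[of "[(X0, X1, 1), (X1, X0, 1), (X2, X3, - 1), (X3, X2, 1)]"]
    by (simp add: sklyanin_rels_def word_simps cocycle_def sgn_if_def algebra_simps)
  moreover have "p X0 * q X2 - p X2 * q X0 = \<beta> * (p X3 * q X1 - p X1 * q X3)"
    using rel'[of "[(X0, X2, 1), (X2, X0, - 1), (X3, X1, - \<beta>), (X1, X3, - \<beta>)]"]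
    by (simp add: sklyanin_rels_def word_simps cocycle_def sgn_if_def algebra_simps)
  moreover have "p X0 * q X2 + p X2 * q X0 = p X3 * q X1 + p X1 * q X3"
    using rel'[of "[(X0, X2, 1), (X2, X0, 1), (X3, X1, - 1), (X1, X3, 1)]"]
    by (simp add: sklyanin_rels_def word_simps cocycle_def sgn_if_def algebra_simps)
  moreover have "p X0 * q X3 - p X3 * q X0 = \<gamma> * (p X2 * q X1 - p X1 * q X2)"
    using rel'[of "[(X0, X3, 1), (X3, X0, - 1), (X1, X2, - \<gamma>), (X2, X1, - \<gamma>)]"]
    by (simp add: sklyanin_rels_def word_simps cocycle_def sgn_if_def algebra_simps)
  moreover have "p X0 * q X3 + p X3 * q X0 = - (p X1 * q X2 + p X2 * q X1)"
    unfolding eq_neg_iff_add_eq_0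
    using rel'[of "[(X0, X3, 1), (X3, X0, 1), (X1, X2, - 1), (X2, X1, 1)]"]
    by (simp add: sklyanin_rels_def word_simps cocycle_def sgn_if_def algebra_simps)
  moreover have "p X1 * q X1 + p X2 * q X2 = p X0 * q X0 + p X3 * q X3"
    using rel[of "[(X0, X0, - 1), (X1, X1, 1), (X2, X2, 1), (X3, X3, 1)]"] to_B_Omega1[of \<alpha> \<beta> \<gamma>]
    by (simp add: word_simps cocycle_def sgn_if_def algebra_simps)
  ultimately have "(p X0 = 0 \<and> p X1 = 0 \<and> p X2 = 0 \<and> p X3 = 0) \<or> (q X0 = 0 \<and> q X1 = 0 \<and> q X2 = 0 \<and> q X3 = 0)"
    by (rule twisted_relations_no_solution[OF two par])
  moreover obtain i j where "p i \<noteq> 0" "q j \<noteq> 0" using p_nz q_nz by blast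
  ultimately show False by (cases i; cases j) simp_all
qed

end

theorem proposition5p2p3:
  fixes \<alpha> \<beta> \<gamma> :: "'k::alg_closed_field"
    and \<sigma> :: "'k point \<Rightarrow> 'k point"
    and M :: "('k free set set, 'm) graded_rmodule"
  assumes "CHAR('k) \<noteq> 2"
    and "sklyanin_params \<alpha> \<beta> \<gamma>"
    and "sklyanin_automorphism \<alpha> \<beta> \<gamma> \<sigma>"
    and "infinite_order_on \<sigma> (curve_E \<alpha> \<beta> \<gamma>)"
  shows "\<not> point_module (B_twist \<alpha> \<beta> \<gamma>) M"
proof -
  have "(2::'k) \<noteq> 0"
  proof
    assume "(2::'k) = 0"
    then have "of_nat 2 = (0::'k)" by simp
    then have "CHAR('k) dvd 2" by (simp only: of_nat_eq_0_iff_char_dvd)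
    then have "CHAR('k) \<le> 2" by (rule dvd_imp_le) simp
    moreover have "CHAR('k) \<noteq> 0" using \<open>CHAR('k) dvd 2\<close> by (metis dvd_0_left_iff zero_neq_numeral)
    moreover have "CHAR('k) \<noteq> 1" by simp
    ultimately show False using assms(1) by linarith
  qed
  \<comment> \<open>\<open>not_point_module\<close> is stated for graded right modules over the
    twist; this property is a conjunct of \<open>point_module\<close>, so an \<open>M\<close>
    without it satisfies the claim trivially.\<close>
  then show ?thesis
    using not_point_module[OF _ _ assms(2)] unfolding point_module_def by blast
qed

end
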